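(* Let $p\ge 3$ be a prime and let $\bar\alpha=(\alpha_1,\dots,\alpha_{p-1})\in\mathbb{GF}(p)^{p-1}$ be a nonsymmetric vector with $\sum_{i=1}^{p-1}\alpha_i=0$. Then the $EGS$-group $\Gamma_{\bar\alpha}$ does not have the congruence property.
   Context: Let $A=\{0,1,\dots,p-1\}$ and let $T$ be the regular rooted $p$-tree whose vertices are the finite words over $A$ (root = empty word, $w$ joined to $wx$ for $x\in A$); $|v|$ is the length of the word $v$. Automorphisms of $T$ (fixing the root) act on the right, $v\mapsto v^g$. For $H\le \mathrm{Aut}\,T$, $\mathrm{Stab}_H(n)$ is the subgroup of elements of $H$ fixing all vertices of length $n$. A subgroup of $H$ is a congruence subgroup if it contains $\mathrm{Stab}_H(n)$ for some $n$. $H$ has the congruence property if every finite index subgroup of $H$ is a congruence subgroup. Let $a,b,c\in\mathrm{Aut}\,T$ be given by: $(jw)^a=(j+1 \bmod p)\,w$ for $j\in A$; $(jw)^b=j\,(w^{a^{\alpha_{j+1}}})$ for $0\le j\le p-2$ and $((p-1)w)^b=(p-1)(w^b)$; $(0w)^c=0(w^c)$ and $(jw)^c=j\,(w^{a^{\alpha_j}})$ for $1\le j\le p-1$. (That is, $b=(a^{\alpha_1},\dots,a^{\alpha_{p-1}},b)$, $c=(c,a^{\alpha_1},\dots,a^{\alpha_{p-1}})$.) The $EGS$-group is $\Gamma_{\bar\alpha}=\langle a,b,c\rangle$; it is defined for vectors with $\sum\alpha_i=0$, and all $EGS$-groups are known to be periodic. The vector $\bar\alpha$ is symmetric if $\alpha_i=\alpha_{p-i}$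 for all $i=1,\dots,\frac{p-1}{2}$, and nonsymmetric otherwise. *)

theory Defs
  imports "HOL-Algebra.Bij" "HOL-Algebra.Coset" "HOL-Algebra.Generated_Groups"
    "HOL-Number_Theory.Residues"
begin

text \<open>A word over the alphabet is a list whose head is its first letter, i.e. the letter
  next to the root; \<open>w\<close> is joined to \<open>w @ [x]\<close>.\<close>

definition tree_verts :: "nat \<Rightarrow> nat list set" where
  "tree_verts p = lists {0..<p}"

definition tree_adj :: "nat \<Rightarrow> nat list \<Rightarrow> nat list \<Rightarrow> bool" where
  "tree_adj p u v \<longleftrightarrow> (\<exists>x<p. v = u @ [x] \<or> u = v @ [x])"

text \<open>Automorphisms of the tree fixing the root. As they act on the right, the product
  \<open>g \<otimes> h\<close> is ``first \<open>g\<close>, then \<open>h\<close>'' (the opposite of the convention of \<open>BijGroup\<close>). Following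
  \<open>Bij\<close>, an automorphism is a function that is \<open>undefined\<close> off the vertex set.\<close>

definition tree_aut :: "nat \<Rightarrow> (nat list \<Rightarrow> nat list) monoid" where
  "tree_aut p =
    \<lparr>carrier = {g \<in> Bij (tree_verts p). g [] = [] \<and>
        (\<forall>u\<in>tree_verts p. \<forall>v\<in>tree_verts p. tree_adj p (g u) (g v) \<longleftrightarrow> tree_adj p u v)},
     monoid.mult = (\<lambda>g h. compose (tree_verts p) h g),
     one = (\<lambda>v\<in>tree_verts p. v)\<rparr>"

definition level_stab :: "nat \<Rightarrow> (nat list \<Rightarrow> nat list) set \<Rightarrow> nat \<Rightarrow> (nat list \<Rightarrow> nat list) set" where
  "level_stab p H n = {h \<in> H. \<forall>v\<in>tree_verts p. length v = n \<longrightarrow> h v = v}"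

definition congruence_subgroup ::
  "nat \<Rightarrow> (nat list \<Rightarrow> nat list) set \<Rightarrow> (nat list \<Rightarrow> nat list) set \<Rightarrow> bool" where
  "congruence_subgroup p H K \<longleftrightarrow>
    subgroup K (tree_aut p\<lparr>carrier := H\<rparr>) \<and> (\<exists>n. level_stab p H n \<subseteq> K)"

definition congruence_property :: "nat \<Rightarrow> (nat list \<Rightarrow> nat list) set \<Rightarrow> bool" where
  "congruence_property p H \<longleftrightarrow>
    (\<forall>K. subgroup K (tree_aut p\<lparr>carrier := H\<rparr>) \<and>
         finite (rcosets\<^bsub>tree_aut p\<lparr>carrier := H\<rparr>\<^esub> K) \<longrightarrow> congruence_subgroup p H K)"

definition egs_a :: "nat \<Rightarrow> nat list \<Rightarrow> nat list" where
  "egs_a p = (\<lambda>v\<in>tree_verts p. case v of [] \<Rightarrow> [] | j # w \<Rightarrow> ((j + 1) mod p) # w)"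

text \<open>An element of \<open>GF(p)\<close> is an integer in \<open>{0..p-1}\<close> (the carrier of \<open>residue_ring\<close>), so it can be
  used directly as an exponent of \<open>a\<close>, which has order \<open>p\<close>.\<close>

primrec egs_b_word :: "nat \<Rightarrow> (nat \<Rightarrow> int) \<Rightarrow> nat list \<Rightarrow> nat list" where
  "egs_b_word p \<alpha> [] = []"
| "egs_b_word p \<alpha> (j # w) =
    (if j = p - 1 then j # egs_b_word p \<alpha> w
     else j # (egs_a p [^]\<^bsub>tree_aut p\<^esub> \<alpha> (j + 1)) w)"

primrec egs_c_word :: "nat \<Rightarrow> (nat \<Rightarrow> int) \<Rightarrow> nat list \<Rightarrow> nat list" where
  "egs_c_word p \<alpha> [] = []"
| "egs_c_word p \<alpha> (j # w) =
    (if j = 0 then j # egs_c_word p \<alpha> w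
     else j # (egs_a p [^]\<^bsub>tree_aut p\<^esub> \<alpha> j) w)"

definition egs_b :: "nat \<Rightarrow> (nat \<Rightarrow> int) \<Rightarrow> nat list \<Rightarrow> nat list" where
  "egs_b p \<alpha> = restrict (egs_b_word p \<alpha>) (tree_verts p)"

definition egs_c :: "nat \<Rightarrow> (nat \<Rightarrow> int) \<Rightarrow> nat list \<Rightarrow> nat list" where
  "egs_c p \<alpha> = restrict (egs_c_word p \<alpha>) (tree_verts p)"

definition EGS_group :: "nat \<Rightarrow> (nat \<Rightarrow> int) \<Rightarrow> (nat list \<Rightarrow> nat list) set" where
  "EGS_group p \<alpha> = generate (tree_aut p) {egs_a p, egs_b p \<alpha>, egs_c p \<alpha>}"

definition symmetric_vector :: "nat \<Rightarrow> (nat \<Rightarrow> int) \<Rightarrow> bool" where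
  "symmetric_vector p \<alpha> \<longleftrightarrow> (\<forall>i\<in>{1..(p - 1) div 2}. \<alpha> i = \<alpha> (p - i))"

end

theory Submission
  imports Defs
begin

text \<open>Let \<open>\<Gamma>\<close> be the EGS-group and \<open>\<Gamma>'\<close> its derived subgroup. The exponent sum of \<open>c\<close> modulo \<open>p\<close>
  in a word that represents an element of \<open>\<Gamma>\<close> depends on the element only
  (\<open>count_GenC_of_trivial_word\<close>), so the elements of exponent sum \<open>0\<close> form a subgroup \<open>K\<close> of finite
  index, which contains \<open>\<Gamma>'\<close>. The congruence topology does not see this exponent sum: every level
  stabilizer contains elements outside \<open>K\<close>.

  To find them, compare \<open>c = (c, a\<^bsup>\<alpha>(1)\<^esup>, \<dots>)\<close> with the conjugate \<open>a\<inverse>ba = (b, a\<^bsup>\<alpha>(1)\<^esup>, \<dots>)\<close>. Their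
  quotient is \<open>d = (cb\<inverse>, 1, \<dots>, 1)\<close>, an element of exponent sum \<open>1\<close>, and \<open>cb\<inverse> = dk\<close> with a
  commutator \<open>k\<close>. If \<open>(h, 1, \<dots>, 1) \<in> \<Gamma>'\<close> for all \<open>h \<in> \<Gamma>'\<close>, then the map \<open>g \<mapsto> (g, 1, \<dots>, 1)\<close>
  preserves the coset \<open>d\<Gamma>'\<close>, because \<open>(dt, 1, \<dots>, 1) = d (k\<inverse>t, 1, \<dots>, 1)\<close> for \<open>t \<in> \<Gamma>'\<close>. Starting
  from \<open>d\<close> and iterating the map \<open>n\<close> times yields an element of \<open>d\<Gamma>'\<close> that fixes the level \<open>n\<close>
  (\<open>deep_elements\<close>); and \<open>d\<Gamma>'\<close> is disjoint from \<open>K\<close>.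

  It remains to see that \<open>\<Gamma>'\<close> is closed under \<open>h \<mapsto> (h, 1, \<dots>, 1)\<close> (\<open>single_D\<close>), and this is where
  the asymmetry of the vector enters. The elements \<open>h\<close> with \<open>(h, 1, \<dots>, 1) \<in> \<Gamma>'\<close> form a normal
  subgroup \<open>R\<close> of \<open>\<Gamma>\<close>, and \<open>\<Gamma>/R\<close> has to be abelian. Let \<open>b\<^sub>j\<close> be the conjugate of \<open>b\<close> by a power of
  \<open>a\<close> that has \<open>b\<close> as its \<open>j\<close>-th coordinate. Whenever a commutator of elements fixing the first
  level is supported on one coordinate modulo \<open>R\<close>, its entry there lies in \<open>R\<close>. Applied to \<open>d\<close> and
  its conjugates this makes \<open>cb\<inverse>\<close> central modulo \<open>R\<close>. Now let \<open>\<alpha>\<^sub>i \<noteq> \<alpha>\<^bsub>-i\<^esub>\<close>, indices modulo \<open>p\<close>, and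
  renumber the coordinates so that \<open>i = 1\<close>. The commutator of \<open>b\<^sub>0\<close> and \<open>b\<^sub>1\<close> has only two
  nontrivial entries. If one of \<open>\<alpha>\<^sub>1\<close>, \<open>\<alpha>\<^bsub>-1\<^esub>\<close> vanishes, one entry disappears. If the vector is a
  geometric sequence, suitable products \<open>b\<^sub>0b\<^sub>1\<^bsup>-q\<^esup>\<close> and \<open>b\<^sub>1b\<^sub>2\<^bsup>-q\<^esup>\<close> overlap at one coordinate. Otherwise
  the entry of the commutator at \<open>0\<close> is central modulo \<open>R\<close>, and comparing it with its neighbours
  all the way around the cycle of coordinates gives its power with exponent \<open>1 - \<alpha>\<^sub>1/\<alpha>\<^bsub>-1\<^esub>\<close>, which is
  prime to \<open>p\<close>; so this entry is in \<open>R\<close>. In all cases \<open>a\<close> and \<open>b\<close> commute modulo \<open>R\<close>.\<close>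

section \<open>Commutators and powers of elements of order \<open>p\<close>\<close>

definition (in group) comm :: "'a \<Rightarrow> 'a \<Rightarrow> 'a" where
  "comm x y = x \<otimes> y \<otimes> inv x \<otimes> inv y"

context group
begin

lemma comm_closed [simp]: "x \<in> carrier G \<Longrightarrow> y \<in> carrier G \<Longrightarrow> comm x y \<in> carrier G"
  by (simp add: comm_def)

lemma comm_eq_one_iff:
  assumes "x \<in> carrier G" "y \<in> carrier G"
  shows "comm x y = \<one> \<longleftrightarrow> x \<otimes> y = y \<otimes> x"
proof -
  have "comm x y = (x \<otimes> y) \<otimes> inv (y \<otimes> x)"
    using assms by (simp add: comm_def inv_mult_group m_assoc)
  then show ?thesis
    using assms by (metis inv_closed inv_equality inv_inv m_closed r_inv)
qed

lemma comm_one [simp]: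
  assumes "x \<in> carrier G"
  shows "comm x \<one> = \<one>" "comm \<one> x = \<one>" "comm x x = \<one>"
  using assms by (simp_all add: comm_eq_one_iff)

lemma inv_comm:
  assumes "x \<in> carrier G" "y \<in> carrier G"
  shows "inv (comm x y) = comm y x"
  using assms by (simp add: comm_def inv_mult_group m_assoc)

lemma commutes_inv:
  assumes "x \<otimes> y = y \<otimes> x" "x \<in> carrier G" "y \<in> carrier G"
  shows "x \<otimes> inv y = inv y \<otimes> x"
  using assms by (metis inv_closed inv_solve_left inv_solve_right m_assoc m_closed)

lemma commutes_mult:
  assumes "x \<otimes> y = y \<otimes> x" "x \<otimes> z = z \<otimes> x" "x \<in> carrier G" "y \<in> carrier G" "z \<in> carrier G"
  shows "x \<otimes> (y \<otimes> z) = (y \<otimes> z) \<otimes> x"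
  using assms by (metis m_assoc)

lemma commutes_int_pow:
  fixes n :: int
  assumes "x \<otimes> y = y \<otimes> x" "x \<in> carrier G" "y \<in> carrier G"
  shows "x \<otimes> y [^] n = y [^] n \<otimes> x"
proof -
  have *: "x \<otimes> y [^] k = y [^] k \<otimes> x" for k :: nat
    using group_commutes_pow[of y x k] assms by simp
  show ?thesis
    by (cases n rule: int_cases2) (simp_all add: int_pow_int int_pow_neg * commutes_inv assms)
qed

lemma int_pow_cong:
  fixes m n p :: int
  assumes "x \<in> carrier G" "x [^] p = \<one>" "p dvd m - n"
  shows "x [^] m = x [^] n"
proof -
  have "int (ord x) dvd p" using assms int_pow_eq_id by blast
  then have "int (ord x) dvd n - m" using assms(3) by (metis dvd_trans dvd_diff_commute)
  then show ?thesis using assms(1) int_pow_eq by blast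
qed

lemma int_pow_cancel:
  fixes n p :: int
  assumes x: "x \<in> carrier G" and xp: "x [^] p = \<one>" and cop: "coprime n p"
  obtains m :: int where "(x [^] n) [^] m = x"
proof -
  obtain m where "[n * m = 1] (mod p)" using cong_solve_coprime_int[OF cop] by blast
  then have "x [^] (n * m) = x [^] (1::int)"
    by (intro int_pow_cong[OF x xp]) (simp add: cong_iff_dvd_diff)
  then show thesis using x that by (simp add: int_pow_pow)
qed

text \<open>An element of order dividing \<open>p\<close> is a power of each of its powers with exponent prime to \<open>p\<close>,
  so both have the same centralizer.\<close>

lemma commutes_of_int_pow:
  fixes n p :: int
  assumes "x \<otimes> y [^] n = y [^] n \<otimes> x" and "x \<in> carrier G" "y \<in> carrier G"
    and "y [^] p = \<one>" "coprime n p"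
  shows "x \<otimes> y = y \<otimes> x"
proof -
  obtain m :: int where "(y [^] n) [^] m = y" using int_pow_cancel assms by metis
  then show ?thesis using commutes_int_pow[of x "y [^] n" m] assms by simp
qed

text \<open>Conjugation by \<open>x\<close> sends \<open>y\<close> to \<open>comm x y \<otimes> y\<close>, a product of two commuting factors,
  so it sends \<open>y [^] n\<close> to the product of their powers.\<close>

lemma comm_int_pow:
  fixes n :: int
  assumes x: "x \<in> carrier G" and y: "y \<in> carrier G" and c: "comm x y \<otimes> y = y \<otimes> comm x y"
  shows "comm x (y [^] n) = comm x y [^] n"
proof -
  have conj: "x \<otimes> y [^] n \<otimes> inv x = (x \<otimes> y \<otimes> inv x) [^] n"
  proof -
    have *: "x \<otimes> y [^] k \<otimes> inv x = (x \<otimes> y \<otimes> inv x) [^] k" for k :: nat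
    proof (induction k)
      case (Suc k)
      have "x \<otimes> y [^] Suc k \<otimes> inv x = (x \<otimes> y [^] k \<otimes> inv x) \<otimes> (x \<otimes> y \<otimes> inv x)"
        using x y by (simp add: m_assoc inv_solve_left)
      then show ?case using Suc by simp
    qed (use x in simp)
    show ?thesis
    proof (cases n rule: int_cases2)
      case (nonneg k) then show ?thesis using * by (simp add: int_pow_int)
    next
      case (nonpos k)
      have "x \<otimes> inv (y [^] k) \<otimes> inv x = inv (x \<otimes> y [^] k \<otimes> inv x)"
        using x y by (simp add: inv_mult_group m_assoc)
      then show ?thesis using * x y nonpos by (simp add: int_pow_int int_pow_neg)
    qed
  qed
  have "x \<otimes> y \<otimes> inv x = comm x y \<otimes> y"
    using x y by (simp add: comm_def m_assoc)
  then have "x \<otimes> y [^] n \<otimes> inv x = comm x y [^] n \<otimes> y [^] n"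
    using conj int_pow_mult_distrib[OF c] x y by simp
  then show ?thesis using x y by (simp add: comm_def m_assoc)
qed

end

section \<open>Tuples whose commutators have small support\<close>

text \<open>The situation after factoring the EGS-group by the elements \<open>h\<close> for which \<open>(h, 1, \<dots>, 1)\<close> lies in
  the derived subgroup. \<open>A\<close>, \<open>B\<close>, \<open>C\<close> are the images of the generators; an element that fixes the
  first level is read as the tuple of the images of its sections, the coordinates being residues
  modulo \<open>p\<close>, that is, periodic functions on the integers. \<open>S\<close> are the tuples that come from the group
  and \<open>E\<close> those that come from the derived subgroup; \<open>E_single\<close> expresses the choice of the normal
  subgroup that has been factored out. The coordinates are numbered so that the defining vector
  \<open>\<beta>\<close> differs at \<open>1\<close> and \<open>-1\<close>. The goal is that the three generators commute.\<close>

locale commutator_tuples = group Q for Q (structure) +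
  fixes p :: int and \<beta> :: "int \<Rightarrow> int" and A B C :: 'a and S E :: "(int \<Rightarrow> 'a) set"
  assumes prime_p: "prime p" and p_ge_3: "p \<ge> 3"
    and \<beta>_periodic: "\<And>k l. p dvd k - l \<Longrightarrow> \<beta> k = \<beta> l"
    and gens: "A \<in> carrier Q" "B \<in> carrier Q" "C \<in> carrier Q"
    and A_pow: "A [^] p = \<one>" and B_pow: "B [^] p = \<one>"
    and S_closed: "\<And>F k. F \<in> S \<Longrightarrow> F k \<in> carrier Q"
    and S_periodic: "\<And>F k l. F \<in> S \<Longrightarrow> p dvd k - l \<Longrightarrow> F k = F l"
    and S_mult: "\<And>F F'. F \<in> S \<Longrightarrow> F' \<in> S \<Longrightarrow> (\<lambda>k. F k \<otimes> F' k) \<in> S"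
    and S_inv: "\<And>F. F \<in> S \<Longrightarrow> (\<lambda>k. inv (F k)) \<in> S"
    and E_S: "E \<subseteq> S" and E_one: "(\<lambda>k. \<one>) \<in> E"
    and E_mult: "\<And>F F'. F \<in> E \<Longrightarrow> F' \<in> E \<Longrightarrow> (\<lambda>k. F k \<otimes> F' k) \<in> E"
    and E_inv: "\<And>F. F \<in> E \<Longrightarrow> (\<lambda>k. inv (F k)) \<in> E"
    and E_comm: "\<And>F F'. F \<in> S \<Longrightarrow> F' \<in> S \<Longrightarrow> (\<lambda>k. comm (F k) (F' k)) \<in> E"
    and E_single: "\<And>F j. F \<in> E \<Longrightarrow> (\<And>k. \<not> p dvd k - j \<Longrightarrow> F k = \<one>) \<Longrightarrow> F j = \<one>"
    and B_in_S: "\<And>j. (\<lambda>k. if p dvd k - j then B else A [^] \<beta> (k - j)) \<in> S"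
    and C_in_S: "\<And>j. (\<lambda>k. if p dvd k - j then C else A [^] \<beta> (k - j)) \<in> S"
    and nonsym: "\<not> p dvd \<beta> 1 - \<beta> (-1)"
begin

abbreviation Bt :: "int \<Rightarrow> int \<Rightarrow> 'a" where
  "Bt j \<equiv> (\<lambda>k. if p dvd k - j then B else A [^] \<beta> (k - j))"

abbreviation Ct :: "int \<Rightarrow> int \<Rightarrow> 'a" where
  "Ct j \<equiv> (\<lambda>k. if p dvd k - j then C else A [^] \<beta> (k - j))"

lemma S_pow:
  assumes "F \<in> S" shows "(\<lambda>k. F k [^] (n::int)) \<in> S"
proof -
  have *: "(\<lambda>k. F k [^] (m::nat)) \<in> S" for m
  proof (induction m)
    case 0 show ?case using E_one E_S by auto
  next
    case (Suc m) then show ?case using S_mult[OF Suc assms] by simp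
  qed
  show ?thesis
  proof (cases n rule: int_cases2)
    case (nonneg m) then show ?thesis using *[of m] by (simp add: int_pow_int)
  next
    case (nonpos m)
    have "F k \<in> carrier Q" for k using assms S_closed by auto
    then show ?thesis using S_inv[OF *[of m]] nonpos by (simp add: int_pow_int int_pow_neg)
  qed
qed

lemma E_pow:
  assumes "F \<in> E" shows "(\<lambda>k. F k [^] (n::int)) \<in> E"
proof -
  have *: "(\<lambda>k. F k [^] (m::nat)) \<in> E" for m
  proof (induction m)
    case 0 show ?case using E_one by auto
  next
    case (Suc m) then show ?case using E_mult[OF Suc assms] by simp
  qed
  show ?thesis
  proof (cases n rule: int_cases2)
    case (nonneg m) then show ?thesis using *[of m] by (simp add: int_pow_int)
  next
    case (nonpos m)
    have "F k \<in> carrier Q" for k using assms S_closed E_S by auto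
    then show ?thesis using E_inv[OF *[of m]] nonpos by (simp add: int_pow_int int_pow_neg)
  qed
qed

text \<open>The way in which \<open>E_single\<close> is used: two tuples that commute at all coordinates but one have
  a commutator supported on one coordinate.\<close>

lemma commute_at:
  assumes F: "F \<in> S" and F': "F' \<in> S"
    and off: "\<And>k. \<not> p dvd k - j \<Longrightarrow> F k \<otimes> F' k = F' k \<otimes> F k"
  shows "F j \<otimes> F' j = F' j \<otimes> F j"
  using E_single[OF E_comm[OF F F'], of j] off S_closed[OF F] S_closed[OF F']
  by (simp add: comm_eq_one_iff)

lemma coprime_p: "\<not> p dvd n \<Longrightarrow> coprime n p"
  using prime_p prime_imp_coprime[of p n] coprime_commute by blast

lemma not_dvd_small: "0 < n \<Longrightarrow> n < p \<Longrightarrow> \<not> p dvd n"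
  using zdvd_not_zless by blast

lemma not_dvd_12: "\<not> p dvd 1" "\<not> p dvd 2" "\<not> p dvd -1" "\<not> p dvd -2"
  using not_dvd_small[of 1] not_dvd_small[of 2] p_ge_3 by auto

lemma A_pow_closed [simp]: "A [^] (n::int) \<in> carrier Q" using gens by simp
lemma B_pow_closed [simp]: "B [^] (n::int) \<in> carrier Q" using gens by simp
lemma A_pows_commute: "A [^] (m::int) \<otimes> A [^] (n::int) = A [^] n \<otimes> A [^] m"
  using gens by (simp add: int_pow_mult[symmetric] add.commute)
lemma A_pow_cong: "p dvd m - n \<Longrightarrow> A [^] m = A [^] n"
  using int_pow_cong gens A_pow by blast

lemma fermat_int:
  assumes "\<not> p dvd q" shows "p dvd q ^ nat (p - 1) - 1"
proof -
  define a where "a = nat (q mod p)"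
  have a: "int a = q mod p" using p_ge_3 by (simp add: a_def)
  have "\<not> int (nat p) dvd int a" using assms a p_ge_3 by (simp add: dvd_mod_iff)
  then have "\<not> nat p dvd a" by presburger
  then have "[a ^ (nat p - 1) = 1] (mod nat p)"
    using prime_p by (intro fermat_theorem) simp_all
  then have "[int a ^ nat (p - 1) = 1] (mod p)"
    using p_ge_3 cong_int_iff[of "a ^ (nat p - 1)" 1 "nat p"] by (simp add: nat_diff_distrib)
  moreover have "[int a ^ nat (p - 1) = q ^ nat (p - 1)] (mod p)"
    using a by (intro cong_pow) simp
  ultimately show ?thesis using cong_trans cong_sym cong_iff_dvd_diff by blast
qed

lemma exists_\<beta>: "\<exists>j. \<not> p dvd j \<and> \<not> p dvd \<beta> j"
  using nonsym not_dvd_12 by (metis dvd_diff)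

text \<open>The quotient of \<open>Ct j\<close> by \<open>Bt j\<close> is supported on the coordinate \<open>j\<close>.\<close>

lemma CB_commutes:
  assumes F: "F \<in> S" shows "(C \<otimes> inv B) \<otimes> F j = F j \<otimes> (C \<otimes> inv B)"
proof -
  have H: "(\<lambda>k. Ct j k \<otimes> inv (Bt j k)) \<in> S" using S_mult[OF C_in_S S_inv[OF B_in_S]] .
  show ?thesis using commute_at[OF H F, of j] S_closed[OF F] gens by simp
qed

text \<open>The coordinates of \<open>Bt 0\<close> include \<open>B\<close> and a nontrivial power of \<open>A\<close>.\<close>

lemma CB_central:
  shows "(C \<otimes> inv B) \<otimes> A = A \<otimes> (C \<otimes> inv B)" "(C \<otimes> inv B) \<otimes> B = B \<otimes> (C \<otimes> inv B)"
proof -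
  obtain j where j: "\<not> p dvd j" "\<not> p dvd \<beta> j" using exists_\<beta> by blast
  have "(C \<otimes> inv B) \<otimes> A [^] \<beta> j = A [^] \<beta> j \<otimes> (C \<otimes> inv B)"
    using CB_commutes[OF B_in_S[of 0], of j] j by simp
  then show "(C \<otimes> inv B) \<otimes> A = A \<otimes> (C \<otimes> inv B)"
    using commutes_of_int_pow[of "C \<otimes> inv B" A] gens A_pow coprime_p[OF j(2)] by simp
  show "(C \<otimes> inv B) \<otimes> B = B \<otimes> (C \<otimes> inv B)"
    using CB_commutes[OF B_in_S[of 0], of 0] by simp
qed

text \<open>Since \<open>C \<otimes> inv B\<close> is central, \<open>C\<close> need not be considered separately from \<open>B\<close>.\<close>

lemma commutes_C:
  assumes "x \<otimes> B = B \<otimes> x" "x \<in> carrier Q" "(C \<otimes> inv B) \<otimes> x = x \<otimes> (C \<otimes> inv B)"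
  shows "x \<otimes> C = C \<otimes> x"
proof -
  have "C = (C \<otimes> inv B) \<otimes> B" using gens by (simp add: m_assoc)
  then show ?thesis using commutes_mult[of x "C \<otimes> inv B" B] assms gens by simp
qed

text \<open>The commutator of \<open>Bt l\<close> and \<open>Bt (l + 1)\<close>: away from \<open>l\<close> and \<open>l + 1\<close> both tuples have powers
  of \<open>A\<close> as coordinates.\<close>

lemma T_in_E:
  "(\<lambda>k. if p dvd k - l then comm B (A [^] \<beta> (-1)) else if p dvd k - (l+1) then comm (A [^] \<beta> 1) B else \<one>) \<in> E"
proof -
  have "(\<lambda>k. comm (Bt l k) (Bt (l+1) k)) \<in> E" using E_comm B_in_S by blast
  also have "(\<lambda>k. comm (Bt l k) (Bt (l+1) k)) =
    (\<lambda>k. if p dvd k - l then comm B (A [^] \<beta> (-1)) else if p dvd k - (l+1) then comm (A [^] \<beta> 1) B else \<one>)"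
  proof
    fix k
    have a: "p dvd k - (l+1) \<Longrightarrow> \<not> p dvd k - l"
      using not_dvd_12(1) dvd_diff[of p "k - l" "k - (l+1)"] by auto
    have b: "p dvd k - (l+1) \<Longrightarrow> \<beta> (k - l) = \<beta> 1" by (rule \<beta>_periodic) (simp add: algebra_simps)
    have c: "p dvd k - l \<Longrightarrow> \<beta> (k - (l+1)) = \<beta> (-1)" by (rule \<beta>_periodic) (simp add: algebra_simps)
    show "comm (Bt l k) (Bt (l+1) k) =
      (if p dvd k - l then comm B (A [^] \<beta> (-1)) else if p dvd k - (l+1) then comm (A [^] \<beta> 1) B else \<one>)"
      using a b c by (auto simp: comm_eq_one_iff A_pows_commute)
  qed
  finally show ?thesis .
qed

text \<open>If exactly one of \<open>\<beta> 1\<close>, \<open>\<beta> (-1)\<close> vanishes, one of the two coordinates in \<open>T_in_E\<close> is trivial,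
  hence so is the other.\<close>

lemma AB_if_vanishing:
  assumes "p dvd \<beta> 1 \<or> p dvd \<beta> (-1)"
  shows "A \<otimes> B = B \<otimes> A"
proof -
  have A1: "A [^] n = \<one>" if "p dvd n" for n :: int using A_pow_cong[of n 0] that by simp
  have "\<exists>n. \<not> p dvd n \<and> B \<otimes> A [^] n = A [^] n \<otimes> B"
  proof (cases "p dvd \<beta> 1")
    case True
    then have "\<not> p dvd \<beta> (-1)" using nonsym dvd_diff by blast
    moreover have "comm B (A [^] \<beta> (-1)) = \<one>"
      using E_single[OF T_in_E[of 0], of 0] True A1 gens by simp
    ultimately show ?thesis using comm_eq_one_iff gens A_pow_closed by blast
  next
    case False
    then have "comm B (A [^] \<beta> (-1)) = \<one>" using assms A1 gens by simp
    then have "comm (A [^] \<beta> 1) B = \<one>"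
      using E_single[OF T_in_E[of 0], of 1] not_dvd_12 by simp
    with False show ?thesis using comm_eq_one_iff gens A_pow_closed by metis
  qed
  then show ?thesis using commutes_of_int_pow[of B A _ p] gens A_pow coprime_p by metis
qed

text \<open>If \<open>\<beta>\<close> is a geometric sequence with ratio \<open>q\<close>, the product of \<open>Bt j\<close> with the power \<open>-q\<close> of
  \<open>Bt (j + 1)\<close> is supported on \<open>j\<close> and \<open>j + 1\<close>. Two consecutive products of this kind overlap
  at one coordinate only, so their entries \<open>A [^] \<beta> 1 \<otimes> B [^] (-q)\<close> and \<open>u = B \<otimes> A [^] (- \<beta> 1)\<close> at that
  coordinate commute. The first entry is \<open>inv u \<otimes> B [^] (1 - q)\<close>, and \<open>q\<close> is not \<open>1\<close> modulo \<open>p\<close> because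
  otherwise \<open>\<beta>\<close> would be constant; so \<open>u\<close> commutes with \<open>B\<close>.\<close>

lemma AB_if_geometric:
  assumes x: "\<not> p dvd \<beta> 1" and y: "\<not> p dvd \<beta> (-1)"
    and geo: "\<And>l. \<not> p dvd l \<Longrightarrow> \<not> p dvd l + 1 \<Longrightarrow> p dvd \<beta> (l + 1) - q * \<beta> l"
  shows "A \<otimes> B = B \<otimes> A"
proof -
  have pow: "p dvd \<beta> (int n + 1) - q ^ n * \<beta> 1" if "int n + 1 < p" for n
    using that
  proof (induction n)
    case (Suc n)
    have "p dvd \<beta> (int (Suc n) + 1) - q * \<beta> (int n + 1)"
      using geo[of "int n + 1"] not_dvd_small[of "int n + 1"] not_dvd_small[of "int n + 2"] Suc.prems
      by (simp add: algebra_simps)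
    moreover have "p dvd q * (\<beta> (int n + 1) - q ^ n * \<beta> 1)" using Suc by simp
    ultimately have "p dvd (\<beta> (int (Suc n) + 1) - q * \<beta> (int n + 1)) + q * (\<beta> (int n + 1) - q ^ n * \<beta> 1)"
      by (rule dvd_add)
    then show ?case by (simp add: algebra_simps)
  qed simp
  define n where "n = nat (p - 2)"
  have n: "int n = p - 2" using p_ge_3 by (simp add: n_def)
  have "\<beta> (p - 1) = \<beta> (-1)" by (rule \<beta>_periodic) simp
  then have last: "p dvd \<beta> (-1) - q ^ n * \<beta> 1" using pow[of n] n by simp
  have q0: "\<not> p dvd q"
  proof
    assume "p dvd q"
    moreover have "0 < n" using n p_ge_3 by linarith
    ultimately have "p dvd q ^ n * \<beta> 1" by (meson dvd_mult2 dvd_power dvd_trans)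
    then have "p dvd (\<beta> (-1) - q ^ n * \<beta> 1) + q ^ n * \<beta> 1" using last dvd_add by blast
    with y show False by simp
  qed
  have fermat: "p dvd q ^ Suc n - 1"
  proof -
    have "nat (p - 1) = Suc n" using p_ge_3 by (simp add: n_def)
    then show ?thesis using fermat_int[OF q0] by simp
  qed
  \<comment> \<open>The recursion cannot pass from \<open>-1\<close> to \<open>1\<close> through \<open>0\<close>; Fermat's little theorem closes the cycle.\<close>
  have wrap: "p dvd q * \<beta> (-1) - \<beta> 1"
  proof -
    have "q * \<beta> (-1) - \<beta> 1 = q * (\<beta> (-1) - q ^ n * \<beta> 1) + (q ^ Suc n - 1) * \<beta> 1"
      by (simp add: algebra_simps)
    then show ?thesis using last fermat by simp
  qed
  have q1: "\<not> p dvd 1 - q"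
  proof
    assume "p dvd 1 - q"
    then have "p dvd (1 - q) * \<beta> (-1) + (q * \<beta> (-1) - \<beta> 1)" using wrap by (intro dvd_add) simp_all
    then show False using nonsym by (simp add: algebra_simps dvd_diff_commute)
  qed
  define H where "H j = (\<lambda>k. Bt j k \<otimes> Bt (j + 1) k [^] (-q))" for j
  have H_S: "H j \<in> S" for j unfolding H_def by (rule S_mult[OF B_in_S S_pow[OF B_in_S]])
  have H_one: "H j k = \<one>" if "\<not> p dvd k - j" "\<not> p dvd k - (j + 1)" for j k
  proof -
    have "H j k = A [^] (\<beta> (k - j) - q * \<beta> (k - (j + 1)))"
      using that gens by (simp add: H_def int_pow_pow int_pow_mult[symmetric] algebra_simps)
    also have "\<dots> = A [^] (0::int)"
      using geo[of "k - (j + 1)"] that by (intro A_pow_cong) (simp add: algebra_simps)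
    finally show ?thesis by simp
  qed
  define u where "u = B \<otimes> A [^] (- \<beta> 1)"
  have u: "u \<in> carrier Q" using gens by (simp add: u_def)
  have "H 0 1 \<otimes> H 1 1 = H 1 1 \<otimes> H 0 1"
  proof (rule commute_at[OF H_S H_S])
    fix k assume k: "\<not> p dvd k - 1"
    have "H 0 k = \<one> \<or> H 1 k = \<one>"
    proof (cases "p dvd k")
      case True
      then have "\<not> p dvd k - 2" using not_dvd_12 by (simp add: dvd_diff_right_iff)
      then show ?thesis using k H_one[of k 1] by simp
    next
      case False then show ?thesis using k H_one[of k 0] by simp
    qed
    then show "H 0 k \<otimes> H 1 k = H 1 k \<otimes> H 0 k" using S_closed[OF H_S] by fastforce
  qed
  moreover have "H 0 1 = A [^] \<beta> 1 \<otimes> B [^] (-q)" using not_dvd_12 by (simp add: H_def)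
  moreover have "H 1 1 = u"
  proof -
    have "H 1 1 = B \<otimes> A [^] (- (q * \<beta> (-1)))"
      using not_dvd_12 gens by (simp add: H_def int_pow_pow algebra_simps)
    also have "A [^] (- (q * \<beta> (-1))) = A [^] (- \<beta> 1)"
      by (rule A_pow_cong) (use wrap in \<open>simp add: dvd_diff_commute\<close>)
    finally show ?thesis by (simp add: u_def)
  qed
  moreover have "A [^] \<beta> 1 \<otimes> B [^] (-q) = inv u \<otimes> B [^] (1 - q)"
  proof -
    have "B [^] (1 - q) = B \<otimes> B [^] (-q)" using gens int_pow_mult[of B 1 "-q"] by simp
    moreover have "inv u = A [^] \<beta> 1 \<otimes> inv B"
      using gens by (simp add: u_def inv_mult_group int_pow_neg)
    ultimately show ?thesis using gens by (simp add: m_assoc) (simp add: m_assoc[symmetric])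
  qed
  ultimately have "u \<otimes> (inv u \<otimes> B [^] (1 - q)) = (inv u \<otimes> B [^] (1 - q)) \<otimes> u" by simp
  then have "u \<otimes> B [^] (1 - q) = B [^] (1 - q) \<otimes> u"
    using u gens by (metis B_pow_closed inv_closed l_inv l_one m_assoc m_closed r_inv)
  then have uB: "u \<otimes> B = B \<otimes> u"
    using commutes_of_int_pow[of u B "1 - q" p] u gens B_pow coprime_p[OF q1] by simp
  have "A [^] (- \<beta> 1) = inv B \<otimes> u" using gens by (simp add: u_def m_assoc[symmetric])
  moreover have "B \<otimes> (inv B \<otimes> u) = (inv B \<otimes> u) \<otimes> B"
    using commutes_mult[of B "inv B" u] uB gens u by simp
  ultimately have "B \<otimes> A [^] (- \<beta> 1) = A [^] (- \<beta> 1) \<otimes> B" by simp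
  then show ?thesis
    using commutes_of_int_pow[of B A "- \<beta> 1" p] gens A_pow coprime_p[of "- \<beta> 1"] x by simp
qed

text \<open>Let \<open>\<theta> = comm B (A [^] \<beta> (-1))\<close> be the entry at \<open>0\<close> of the commutator of \<open>Bt 0\<close> and \<open>Bt 1\<close>. It
  commutes with the entry at \<open>0\<close> of every tuple that is trivial at \<open>1\<close>. One such tuple, which exists
  because \<open>\<beta>\<close> is not geometric, has a nontrivial power of \<open>A\<close> there, another one has
  \<open>B [^] \<beta> (-1)\<close> times a power of \<open>A\<close>; so \<open>\<theta>\<close> commutes with \<open>A\<close> and \<open>B\<close>. Then commutators of \<open>B\<close> with
  powers of \<open>A\<close> are powers of \<open>\<theta>\<close>, and \<open>T_in_E\<close> says that the tuple with \<open>\<theta>\<close> at \<open>l\<close> and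
  \<open>\<theta> [^] (-r)\<close> at \<open>l + 1\<close> lies in \<open>E\<close>, where \<open>r = \<beta> 1 / \<beta> (-1)\<close>. Going once around the cycle of
  coordinates makes \<open>\<theta> [^] (1 - r ^ p)\<close> trivial, and \<open>r ^ p = r \<noteq> 1\<close> modulo \<open>p\<close>.\<close>

lemma AB_if_not_geometric:
  assumes x: "\<not> p dvd \<beta> 1" and y: "\<not> p dvd \<beta> (-1)"
    and l: "\<not> p dvd l" "\<not> p dvd l + 1" and ngeo: "\<not> p dvd \<beta> 1 * \<beta> (l + 1) - \<beta> 2 * \<beta> l"
  shows "A \<otimes> B = B \<otimes> A"
proof -
  define \<theta> where "\<theta> = comm B (A [^] \<beta> (-1))"
  have \<theta>: "\<theta> \<in> carrier Q" using gens by (simp add: \<theta>_def)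
  have commutes_\<theta>: "\<theta> \<otimes> H 0 = H 0 \<otimes> \<theta>" if H: "H \<in> S" "H 1 = \<one>" for H
  proof -
    let ?T = "\<lambda>k. if p dvd k - 0 then comm B (A [^] \<beta> (-1))
      else if p dvd k - (0+1) then comm (A [^] \<beta> 1) B else \<one>"
    have T: "?T \<in> S" using T_in_E E_S by blast
    have "?T 0 \<otimes> H 0 = H 0 \<otimes> ?T 0"
    proof (rule commute_at[OF T H(1)])
      fix k assume k: "\<not> p dvd k - 0"
      show "?T k \<otimes> H k = H k \<otimes> ?T k"
      proof (cases "p dvd k - 1")
        case True
        then have "H k = \<one>" using S_periodic[OF H(1), of k 1] H(2) by simp
        then show ?thesis using S_closed[OF T] gens by simp
      next
        case False then show ?thesis using k S_closed[OF H(1)] by simp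
      qed
    qed
    then show ?thesis by (simp add: \<theta>_def)
  qed
  have \<theta>A: "\<theta> \<otimes> A = A \<otimes> \<theta>"
  proof -
    define H where "H = (\<lambda>k. Bt (-l) k [^] \<beta> 2 \<otimes> Bt (-1) k [^] (- \<beta> (l + 1)))"
    have H: "H \<in> S" unfolding H_def by (rule S_mult[OF S_pow[OF B_in_S] S_pow[OF B_in_S]])
    have "H 1 = A [^] (\<beta> (l + 1) * \<beta> 2) \<otimes> A [^] (- (\<beta> 2 * \<beta> (l + 1)))"
      using l not_dvd_12 gens by (simp add: H_def int_pow_pow add.commute[of 1 l])
    then have "H 1 = \<one>" using gens by (simp add: mult.commute int_pow_neg)
    moreover have "H 0 = A [^] (\<beta> l * \<beta> 2 + - (\<beta> 1 * \<beta> (l + 1)))"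
      using l not_dvd_12 gens by (simp add: H_def int_pow_pow int_pow_mult del: add_uminus_conv_diff)
    moreover have "coprime (\<beta> l * \<beta> 2 + - (\<beta> 1 * \<beta> (l + 1))) p"
      using ngeo by (intro coprime_p) (simp add: mult.commute dvd_diff_commute)
    ultimately show ?thesis
      using commutes_\<theta>[OF H] commutes_of_int_pow[of \<theta> A _ p] \<theta> gens A_pow by metis
  qed
  have \<theta>B: "\<theta> \<otimes> B = B \<otimes> \<theta>"
  proof -
    define H where "H = (\<lambda>k. Bt 0 k [^] \<beta> (-1) \<otimes> Bt 2 k [^] (- \<beta> 1))"
    have H: "H \<in> S" unfolding H_def by (rule S_mult[OF S_pow[OF B_in_S] S_pow[OF B_in_S]])
    have "H 1 = A [^] (\<beta> 1 * \<beta> (-1)) \<otimes> A [^] (- (\<beta> (-1) * \<beta> 1))"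
      using not_dvd_12 gens by (simp add: H_def int_pow_pow)
    then have "H 1 = \<one>" using gens by (simp add: mult.commute int_pow_neg)
    then have c: "\<theta> \<otimes> H 0 = H 0 \<otimes> \<theta>" by (rule commutes_\<theta>[OF H])
    define s where "s = \<beta> (-2) * (- \<beta> 1)"
    have H0: "H 0 = B [^] \<beta> (-1) \<otimes> A [^] s"
      using not_dvd_12 gens by (simp add: H_def int_pow_pow s_def)
    have "\<theta> \<otimes> inv (A [^] s) = inv (A [^] s) \<otimes> \<theta>"
      using \<theta>A \<theta> gens by (intro commutes_inv commutes_int_pow) auto
    then have "\<theta> \<otimes> (H 0 \<otimes> inv (A [^] s)) = (H 0 \<otimes> inv (A [^] s)) \<otimes> \<theta>"
      using c \<theta> S_closed[OF H] by (intro commutes_mult) auto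
    moreover have "H 0 \<otimes> inv (A [^] s) = B [^] \<beta> (-1)" using H0 by (simp add: m_assoc)
    ultimately show ?thesis
      using commutes_of_int_pow[of \<theta> B "\<beta> (-1)" p] \<theta> gens B_pow coprime_p[OF y] by simp
  qed
  obtain m where "[\<beta> (-1) * m = 1] (mod p)" using cong_solve_coprime_int[OF coprime_p[OF y]] by blast
  then have "[\<beta> (-1) * (m * \<beta> 1) = \<beta> 1] (mod p)"
    using cong_scalar_right[of "\<beta> (-1) * m" 1 p "\<beta> 1"] by (simp add: mult.assoc)
  then obtain r where r: "p dvd \<beta> (-1) * r - \<beta> 1" by (metis cong_iff_dvd_diff)
  have \<theta>Am: "\<theta> \<otimes> A [^] (n::int) = A [^] n \<otimes> \<theta>" for n using commutes_int_pow \<theta>A \<theta> gens by blast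
  have \<theta>_pow: "comm B (A [^] (\<beta> (-1) * n)) = \<theta> [^] n" for n :: int
    using comm_int_pow[of B "A [^] \<beta> (-1)" n] \<theta>Am gens by (simp add: int_pow_pow \<theta>_def)
  have \<theta>p: "\<theta> [^] p = \<one>"
  proof -
    have "A [^] (\<beta> (-1) * p) = A [^] (0::int)" by (rule A_pow_cong) simp
    then show ?thesis using \<theta>_pow[of p] gens by simp
  qed
  have other: "comm (A [^] \<beta> 1) B = \<theta> [^] (-r)"
  proof -
    have "A [^] \<beta> 1 = A [^] (\<beta> (-1) * r)" by (rule A_pow_cong) (use r in \<open>simp add: dvd_diff_commute\<close>)
    then have "comm B (A [^] \<beta> 1) = \<theta> [^] r" using \<theta>_pow by simp
    then show ?thesis using inv_comm[of B "A [^] \<beta> 1"] gens \<theta> by (simp add: int_pow_neg)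
  qed
  define e where "e j k = (if p dvd k - j then 1 else 0::int)" for j k
  have step: "(\<lambda>k. \<theta> [^] (e j k - r * e (j + 1) k)) \<in> E" for j
  proof -
    have "(\<lambda>k. if p dvd k - j then \<theta> else if p dvd k - (j+1) then \<theta> [^] (-r) else \<one>) =
       (\<lambda>k. \<theta> [^] (e j k - r * e (j + 1) k))"
    proof
      fix k
      have "\<not> (p dvd k - j \<and> p dvd k - (j + 1))"
        using not_dvd_12(1) dvd_diff[of p "k - j" "k - (j+1)"] by auto
      then show "(if p dvd k - j then \<theta> else if p dvd k - (j+1) then \<theta> [^] (-r) else \<one>)
          = \<theta> [^] (e j k - r * e (j + 1) k)"
        using \<theta> by (auto simp: e_def)
    qed
    then show ?thesis using T_in_E[of j] unfolding other \<theta>_def[symmetric] by simp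
  qed
  have tele: "(\<lambda>k. \<theta> [^] (e 0 k - r ^ n * e (int n) k)) \<in> E" for n
  proof (induction n)
    case 0 then show ?case using E_one by simp
  next
    case (Suc n)
    have "(\<lambda>k. \<theta> [^] (e 0 k - r ^ n * e (int n) k) \<otimes>
        (\<theta> [^] (e (int n) k - r * e (int n + 1) k)) [^] (r ^ n)) \<in> E"
      by (rule E_mult[OF Suc E_pow[OF step]])
    also have "(\<lambda>k. \<theta> [^] (e 0 k - r ^ n * e (int n) k) \<otimes>
        (\<theta> [^] (e (int n) k - r * e (int n + 1) k)) [^] (r ^ n))
       = (\<lambda>k. \<theta> [^] (e 0 k - r ^ Suc n * e (int (Suc n)) k))"
      using \<theta> by (simp add: int_pow_pow int_pow_mult[symmetric] algebra_simps)
    finally show ?case .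
  qed
  have "\<theta> [^] (e 0 0 - r ^ nat p * e (int (nat p)) 0) = \<one>"
    by (rule E_single[OF tele]) (use p_ge_3 in \<open>simp add: e_def dvd_diff_left_iff\<close>)
  then have *: "\<theta> [^] (1 - r ^ nat p) = \<one>" using p_ge_3 by (simp add: e_def)
  have "p dvd r ^ nat p - r"
  proof (cases "p dvd r")
    case True
    then show ?thesis using p_ge_3 by (intro dvd_diff dvd_trans[OF True] dvd_power) auto
  next
    case False
    have "p dvd r * (r ^ nat (p - 1) - 1)" using fermat_int[OF False] by simp
    moreover have "r * r ^ nat (p - 1) = r ^ nat p"
      using p_ge_3 by (simp add: power_Suc[symmetric] Suc_nat_eq_nat_zadd1 del: power_Suc)
    ultimately show ?thesis by (simp add: algebra_simps)
  qed
  then have "p dvd (1 - r) - (1 - r ^ nat p)" by simp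
  then have **: "\<theta> [^] (1 - r) = \<one>" using * int_pow_cong[OF \<theta> \<theta>p] by metis
  have "\<not> p dvd 1 - r"
  proof
    assume "p dvd 1 - r"
    then have "p dvd \<beta> (-1) * (1 - r) + (\<beta> (-1) * r - \<beta> 1)" using r by (intro dvd_add) simp_all
    then show False using nonsym by (simp add: algebra_simps dvd_diff_commute)
  qed
  then obtain n :: int where "(\<theta> [^] (1 - r)) [^] n = \<theta>"
    using int_pow_cancel[OF \<theta> \<theta>p] coprime_p by blast
  then have "\<theta> = \<one>" using ** by simp
  then have "B \<otimes> A [^] \<beta> (-1) = A [^] \<beta> (-1) \<otimes> B" using gens by (simp add: \<theta>_def comm_eq_one_iff)
  then show ?thesis
    using commutes_of_int_pow[of B A "\<beta> (-1)" p] gens A_pow coprime_p[OF y] by simp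
qed

theorem gens_commute:
  "A \<otimes> B = B \<otimes> A" "A \<otimes> C = C \<otimes> A" "B \<otimes> C = C \<otimes> B"
proof -
  show AB: "A \<otimes> B = B \<otimes> A"
  proof (cases "p dvd \<beta> 1 \<or> p dvd \<beta> (-1)")
    case True then show ?thesis by (rule AB_if_vanishing)
  next
    case False
    obtain m where m: "[\<beta> 1 * m = 1] (mod p)" using cong_solve_coprime_int[OF coprime_p] False by blast
    define q where "q = m * \<beta> 2"
    have q: "p dvd \<beta> 1 * q - \<beta> 2"
      using cong_scalar_right[OF m, of "\<beta> 2"] by (simp add: q_def cong_iff_dvd_diff mult.assoc)
    show ?thesis
    proof (cases "\<exists>l. \<not> p dvd l \<and> \<not> p dvd l + 1 \<and> \<not> p dvd \<beta> 1 * \<beta> (l + 1) - \<beta> 2 * \<beta> l")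
      case True then show ?thesis using AB_if_not_geometric False by blast
    next
      case geo: False
      have "p dvd \<beta> (l + 1) - q * \<beta> l" if "\<not> p dvd l" "\<not> p dvd l + 1" for l
      proof -
        have "p dvd (\<beta> 1 * \<beta> (l + 1) - \<beta> 2 * \<beta> l) - (\<beta> 1 * q - \<beta> 2) * \<beta> l"
          using geo that dvd_mult2[OF q, of "\<beta> l"] dvd_diff by blast
        then have "p dvd \<beta> 1 * (\<beta> (l + 1) - q * \<beta> l)" by (simp add: algebra_simps)
        then show ?thesis using False prime_p by (simp add: prime_dvd_mult_iff)
      qed
      then show ?thesis using AB_if_geometric False by blast
    qed
  qed
  show "A \<otimes> C = C \<otimes> A" using commutes_C[of A] AB CB_central gens by simp
  show "B \<otimes> C = C \<otimes> B" using commutes_C[of B] CB_central gens by simp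
qed

end

section \<open>Automorphisms of the tree\<close>

lemma tree_adj_simps [simp]:
  "tree_adj p [] v \<longleftrightarrow> (\<exists>x<p. v = [x])"
  "tree_adj p v [] \<longleftrightarrow> (\<exists>x<p. v = [x])"
  "tree_adj p (j # u) (k # v) \<longleftrightarrow> j = k \<and> tree_adj p u v"
  by (auto simp: tree_adj_def)

lemma tree_verts_simps [simp]:
  "[] \<in> tree_verts p" "j # w \<in> tree_verts p \<longleftrightarrow> j < p \<and> w \<in> tree_verts p"
  by (auto simp: tree_verts_def)

lemma tree_aut_fields:
  "carrier (tree_aut p) = {g \<in> Bij (tree_verts p). g [] = [] \<and>
     (\<forall>u\<in>tree_verts p. \<forall>v\<in>tree_verts p. tree_adj p (g u) (g v) \<longleftrightarrow> tree_adj p u v)}"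
  "g \<otimes>\<^bsub>tree_aut p\<^esub> h = compose (tree_verts p) h g"
  "\<one>\<^bsub>tree_aut p\<^esub> = (\<lambda>v\<in>tree_verts p. v)"
  by (simp_all add: tree_aut_def)

lemma aut_Bij: "g \<in> carrier (tree_aut p) \<Longrightarrow> g \<in> Bij (tree_verts p)"
  by (simp add: tree_aut_fields)

lemma aut_closed [simp]: "g \<in> carrier (tree_aut p) \<Longrightarrow> v \<in> tree_verts p \<Longrightarrow> g v \<in> tree_verts p"
  using Bij_imp_funcset[OF aut_Bij] by blast

lemma aut_Nil: "g \<in> carrier (tree_aut p) \<Longrightarrow> g [] = []"
  by (simp add: tree_aut_fields)

lemma mult_apply [simp]: "v \<in> tree_verts p \<Longrightarrow> (g \<otimes>\<^bsub>tree_aut p\<^esub> h) v = h (g v)"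
  by (simp add: tree_aut_fields compose_def)

lemma one_apply [simp]: "v \<in> tree_verts p \<Longrightarrow> \<one>\<^bsub>tree_aut p\<^esub> v = v"
  by (simp add: tree_aut_fields)

lemma aut_eqI:
  assumes "g \<in> carrier (tree_aut p)" "h \<in> carrier (tree_aut p)"
    and "\<And>v. v \<in> tree_verts p \<Longrightarrow> g v = h v"
  shows "g = h"
  using assms extensionalityI[of g "tree_verts p" h] Bij_imp_extensional[OF aut_Bij] by blast

lemma group_tree_aut: "group (tree_aut p)"
proof (rule groupI)
  fix g h k assume g: "g \<in> carrier (tree_aut p)"
    and h: "h \<in> carrier (tree_aut p)" and k: "k \<in> carrier (tree_aut p)"
  have "compose (tree_verts p) h g \<in> Bij (tree_verts p)" using g h by (simp add: compose_Bij aut_Bij)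
  then show "g \<otimes>\<^bsub>tree_aut p\<^esub> h \<in> carrier (tree_aut p)"
    using g h aut_closed[OF g] unfolding tree_aut_fields by (simp add: compose_def del: aut_closed)
  show "g \<otimes>\<^bsub>tree_aut p\<^esub> h \<otimes>\<^bsub>tree_aut p\<^esub> k = g \<otimes>\<^bsub>tree_aut p\<^esub> (h \<otimes>\<^bsub>tree_aut p\<^esub> k)"
    using Bij_imp_funcset[OF aut_Bij[OF g]] by (simp add: tree_aut_fields(2) compose_assoc)
next
  show "\<one>\<^bsub>tree_aut p\<^esub> \<in> carrier (tree_aut p)"
    by (simp add: tree_aut_fields id_Bij del: aut_closed)
next
  fix g assume g: "g \<in> carrier (tree_aut p)"
  then show "\<one>\<^bsub>tree_aut p\<^esub> \<otimes>\<^bsub>tree_aut p\<^esub> g = g"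
    using compose_Id[OF Bij_imp_funcset Bij_imp_extensional, OF aut_Bij aut_Bij, OF g g]
    by (simp add: tree_aut_fields(2,3))
  let ?V = "tree_verts p"
  let ?i = "\<lambda>v\<in>?V. inv_into ?V g v"
  have bij: "bij_betw g ?V ?V" using aut_Bij[OF g] by (simp add: Bij_def)
  have gi: "g (?i v) = v" "?i v \<in> ?V" if "v \<in> ?V" for v
    using bij that by (simp_all add: bij_betw_inv_into_right Bij_inv_into_mem aut_Bij[OF g])
  have "?i [] = []"
    using bij_betw_inv_into_left[OF bij, of "[]"] aut_Nil[OF g] by simp
  moreover have "tree_adj p (?i u) (?i v) \<longleftrightarrow> tree_adj p u v" if "u \<in> ?V" "v \<in> ?V" for u v
  proof -
    have "tree_adj p (g (?i u)) (g (?i v)) \<longleftrightarrow> tree_adj p (?i u) (?i v)"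
      using g gi(2) that unfolding tree_aut_fields by blast
    then show ?thesis using gi(1) that by simp
  qed
  ultimately have "?i \<in> carrier (tree_aut p)"
    using restrict_inv_into_Bij[OF aut_Bij[OF g]]
    by (simp add: tree_aut_fields(1) del: restrict_apply' aut_closed)
  moreover have "?i \<otimes>\<^bsub>tree_aut p\<^esub> g = \<one>\<^bsub>tree_aut p\<^esub>"
    using gi(1) by (auto simp: tree_aut_fields(2,3) compose_def)
  ultimately show "\<exists>h\<in>carrier (tree_aut p). h \<otimes>\<^bsub>tree_aut p\<^esub> g = \<one>\<^bsub>tree_aut p\<^esub>" by blast
qed

text \<open>A function that permutes the first letters and acts on the subtrees by automorphisms is an
  automorphism. For one letter \<open>j0\<close> the function on the subtree may be \<open>h\<close> itself, in which case the
  claim follows by induction on the length of words; this covers the generators \<open>b\<close> and \<open>c\<close>.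
  A value \<open>j0 \<ge> p\<close> means that there is no such letter.\<close>

lemma aut_by_sections:
  assumes ext: "h \<in> extensional (tree_verts p)" and Nil: "h [] = []"
    and \<sigma>: "bij_betw \<sigma> {..<p} {..<p}"
    and f: "\<And>j. j < p \<Longrightarrow> j \<noteq> j0 \<Longrightarrow> f j \<in> carrier (tree_aut p)"
    and Cons: "\<And>j w. j < p \<Longrightarrow> w \<in> tree_verts p \<Longrightarrow> h (j # w) = \<sigma> j # (if j = j0 then h w else f j w)"
  shows "h \<in> carrier (tree_aut p)"
proof -
  let ?V = "tree_verts p"
  have \<sigma>_less: "\<sigma> j < p" if "j < p" for j using bij_betwE[OF \<sigma>] that by auto
  have \<sigma>_inj: "\<sigma> j = \<sigma> k \<longleftrightarrow> j = k" if "j < p" "k < p" for j k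
    using bij_betw_imp_inj_on[OF \<sigma>] that by (auto simp: inj_on_def)
  have bij: "bij_betw (f j) ?V ?V" if "j < p" "j \<noteq> j0" for j
    using aut_Bij[OF f] that by (simp add: Bij_def)
  have f_Nil: "f j v = [] \<longleftrightarrow> v = []" if "j < p" "j \<noteq> j0" "v \<in> ?V" for j v
    using inj_onD[OF bij_betw_imp_inj_on[OF bij], of j v "[]"] aut_Nil[OF f[of j]] that by auto
  have mem: "h v \<in> ?V" if "v \<in> ?V" for v
    using that by (induction v) (auto simp: Nil Cons \<sigma>_less f)
  have inj: "u = v" if "u \<in> ?V" "v \<in> ?V" "h u = h v" for u v
    using that
  proof (induction u arbitrary: v)
    case Nil then show ?case using Cons assms(2) by (cases v) auto
  next
    case (Cons j u)
    then obtain k w where v: "v = k # w" using assms(2,5) by (cases v) auto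
    have jk: "j = k" using Cons.prems v by (auto simp: assms(5) \<sigma>_inj split: if_splits)
    then show ?case
      using Cons v bij[of j] by (auto simp: assms(5) bij_betw_def inj_on_def split: if_splits)
  qed
  have surj: "\<exists>u\<in>?V. h u = v" if "v \<in> ?V" for v
    using that
  proof (induction v)
    case Nil then show ?case using assms(2) by (intro bexI[of _ "[]"]) auto
  next
    case (Cons k v)
    have "k \<in> \<sigma> ` {..<p}" using \<sigma> Cons.prems by (simp add: bij_betw_def)
    then obtain j where j: "j < p" "\<sigma> j = k" by auto
    have "\<exists>u\<in>?V. (if j = j0 then h u else f j u) = v"
    proof (cases "j = j0")
      case False
      then have "v \<in> f j ` ?V" using bij[of j] j Cons.prems by (auto simp: bij_betw_def)
      then show ?thesis using False by auto
    qed (use Cons in auto)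
    then obtain u where "u \<in> ?V" "(if j = j0 then h u else f j u) = v" by blast
    then show ?case using j assms(5) by (intro bexI[of _ "j # u"]) auto
  qed
  have adj: "tree_adj p (h u) (h v) \<longleftrightarrow> tree_adj p u v" if "u \<in> ?V" "v \<in> ?V" for u v
    using that
  proof (induction u arbitrary: v)
    case Nil
    show ?case
    proof (cases v)
      case (Cons k w)
      have "h w = [] \<longleftrightarrow> w = []" using inj[of w "[]"] Cons Nil assms(2) by auto
      moreover have "k \<noteq> j0 \<Longrightarrow> f k w = [] \<longleftrightarrow> w = []"
        using f_Nil[of k w] Cons Nil by simp
      ultimately show ?thesis using Nil Cons assms(2) by (auto simp: assms(5) \<sigma>_less)
    qed (simp add: assms(2))
  next
    case (Cons j u)
    show ?case
    proof (cases v)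
      case Nil
      have "h u = [] \<longleftrightarrow> u = []" using inj[of u "[]"] Cons assms(2) by auto
      moreover have "j \<noteq> j0 \<Longrightarrow> f j u = [] \<longleftrightarrow> u = []"
        using f_Nil[of j u] Cons.prems by simp
      ultimately show ?thesis using Nil Cons.prems assms(2) by (auto simp: assms(5) \<sigma>_less)
    next
      case v: (Cons k w)
      have fj: "tree_adj p (f j u) (f j w) \<longleftrightarrow> tree_adj p u w" if "j \<noteq> j0"
        using f[of j] that Cons.prems v unfolding tree_aut_fields by auto
      show ?thesis using Cons v fj by (auto simp: assms(5) \<sigma>_inj)
    qed
  qed
  have "h ` ?V = ?V" using mem surj by blast
  then have "bij_betw h ?V ?V" using inj by (auto simp: bij_betw_def inj_on_def)
  then show ?thesis using ext Nil adj by (simp add: tree_aut_fields(1) Bij_def del: aut_closed)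
qed

text \<open>The automorphism that fixes the first level and has the sections \<open>f 0, \<dots>, f (p - 1)\<close>. The
  coordinates are integers in order that they can be shifted modulo \<open>p\<close> freely.\<close>

definition tuple :: "nat \<Rightarrow> (int \<Rightarrow> nat list \<Rightarrow> nat list) \<Rightarrow> nat list \<Rightarrow> nat list" where
  "tuple p f = (\<lambda>v\<in>tree_verts p. case v of [] \<Rightarrow> [] | k # w \<Rightarrow> k # f (int k) w)"

lemma tuple_apply [simp]:
  "tuple p f [] = []" "k < p \<Longrightarrow> w \<in> tree_verts p \<Longrightarrow> tuple p f (k # w) = k # f (int k) w"
  by (simp_all add: tuple_def)

lemma tuple_closed:
  assumes "\<And>k. f k \<in> carrier (tree_aut p)"
  shows "tuple p f \<in> carrier (tree_aut p)"
proof (rule aut_by_sections)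
  show "bij_betw id {..<p} {..<p}" by simp
  show "f (int k) \<in> carrier (tree_aut p)" if "k < p" "k \<noteq> p" for k using assms .
qed (auto simp: tuple_def)

section \<open>The EGS-group as a set of words\<close>

datatype generator = GenA | GenB | GenC

locale egs =
  fixes p :: nat and \<alpha> :: "nat \<Rightarrow> int"
  assumes p_prime: "prime p" and p_ge_3: "p \<ge> 3"
    and \<alpha>_range: "\<And>i. 1 \<le> i \<Longrightarrow> i < p \<Longrightarrow> 0 \<le> \<alpha> i \<and> \<alpha> i < int p"
    and \<alpha>_nonsym: "\<exists>i\<ge>1. i < p \<and> \<alpha> i \<noteq> \<alpha> (p - i)"
begin

sublocale group "tree_aut p" by (rule group_tree_aut)

abbreviation G where "G \<equiv> tree_aut p"
abbreviation V where "V \<equiv> tree_verts p"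
abbreviation mul (infixl "\<odot>" 70) where "g \<odot> h \<equiv> g \<otimes>\<^bsub>tree_aut p\<^esub> h"
abbreviation neutral ("\<epsilon>") where "\<epsilon> \<equiv> \<one>\<^bsub>tree_aut p\<^esub>"
abbreviation a where "a \<equiv> egs_a p"
abbreviation b where "b \<equiv> egs_b p \<alpha>"
abbreviation c where "c \<equiv> egs_c p \<alpha>"

lemmas G_Nil [simp] = aut_Nil[of _ p]

lemma p_pos: "0 < p" "1 < p" using p_ge_3 by auto

lemma Suc_mod_bij: "bij_betw (\<lambda>j. (j + 1) mod p) {..<p} {..<p}"
proof -
  have "inj_on (\<lambda>j. (j + 1) mod p) {..<p}"
    by (auto simp: inj_on_def mod_Suc split: if_splits)
  moreover have "(\<lambda>j. (j + 1) mod p) ` {..<p} \<subseteq> {..<p}" using p_pos by auto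
  ultimately show ?thesis by (simp add: bij_betw_def endo_inj_surj)
qed

lemma a_apply [simp]: "a [] = []" "j < p \<Longrightarrow> w \<in> V \<Longrightarrow> a (j # w) = ((j + 1) mod p) # w"
  by (simp_all add: egs_a_def)

lemma a_closed [simp]: "a \<in> carrier G"
proof (rule aut_by_sections[OF _ _ Suc_mod_bij])
  show "a (j # w) = (j + 1) mod p # (if j = p then a w else \<epsilon> w)" if "j < p" "w \<in> V" for j w
    using that by simp
qed (auto simp: egs_a_def)

lemma b_apply [simp]:
  "b [] = []"
  "j < p \<Longrightarrow> w \<in> V \<Longrightarrow> b (j # w) = j # (if j = p - 1 then b w else (a [^]\<^bsub>G\<^esub> \<alpha> (j + 1)) w)"
  by (simp_all add: egs_b_def)

lemma c_apply [simp]: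
  "c [] = []"
  "j < p \<Longrightarrow> w \<in> V \<Longrightarrow> c (j # w) = j # (if j = 0 then c w else (a [^]\<^bsub>G\<^esub> \<alpha> j) w)"
  by (simp_all add: egs_c_def)

lemma b_closed [simp]: "b \<in> carrier G"
proof (rule aut_by_sections)
  show "bij_betw id {..<p} {..<p}" by simp
  show "b (j # w) = id j # (if j = p - 1 then b w else (a [^]\<^bsub>G\<^esub> \<alpha> (j + 1)) w)" if "j < p" "w \<in> V" for j w
    using that by simp
qed (auto simp: egs_b_def)

lemma c_closed [simp]: "c \<in> carrier G"
proof (rule aut_by_sections)
  show "bij_betw id {..<p} {..<p}" by simp
  show "c (j # w) = id j # (if j = 0 then c w else (a [^]\<^bsub>G\<^esub> \<alpha> j) w)" if "j < p" "w \<in> V" for j w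
    using that by simp
qed (auto simp: egs_c_def)

lemma a_pow_apply:
  "j < p \<Longrightarrow> w \<in> V \<Longrightarrow> (a [^]\<^bsub>G\<^esub> (n::nat)) (j # w) = ((j + n) mod p) # w"
  by (induction n) (use p_pos in \<open>auto simp: mod_Suc_eq\<close>)

lemma a_pow_eq_one_iff: "a [^]\<^bsub>G\<^esub> (n::nat) = \<epsilon> \<longleftrightarrow> p dvd n"
proof
  assume "a [^]\<^bsub>G\<^esub> n = \<epsilon>"
  then have "(a [^]\<^bsub>G\<^esub> n) [0] = [0]" using p_pos by simp
  then show "p dvd n" using a_pow_apply[of 0 "[]" n] p_pos by auto
next
  assume n: "p dvd n"
  show "a [^]\<^bsub>G\<^esub> n = \<epsilon>"
  proof (rule aut_eqI[of _ p])
    fix v assume "v \<in> V"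
    then show "(a [^]\<^bsub>G\<^esub> n) v = \<epsilon> v"
      using n a_pow_apply by (cases v) (auto simp: mod_add_eq dvd_imp_mod_0 elim!: dvdE)
  qed auto
qed

lemma a_pow_p: "a [^]\<^bsub>G\<^esub> p = \<epsilon>" by (simp add: a_pow_eq_one_iff)

lemma a_int_pow_p: "(a [^]\<^bsub>G\<^esub> (m::int)) [^]\<^bsub>G\<^esub> p = \<epsilon>"
proof -
  have "(a [^]\<^bsub>G\<^esub> m) [^]\<^bsub>G\<^esub> int p = (a [^]\<^bsub>G\<^esub> int p) [^]\<^bsub>G\<^esub> m"
    by (simp add: int_pow_pow mult.commute)
  then show ?thesis by (simp add: int_pow_int a_pow_p)
qed

lemma pow_apply_Cons:
  assumes g: "g \<in> carrier G" and j: "j < p" and f: "f \<in> carrier G"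
    and gj: "\<And>w. w \<in> V \<Longrightarrow> g (j # w) = j # f w" and w: "w \<in> V"
  shows "(g [^]\<^bsub>G\<^esub> (n::nat)) (j # w) = j # (f [^]\<^bsub>G\<^esub> n) w"
  by (induction n) (use g j f gj w in auto)

lemma b_pow_p: "b [^]\<^bsub>G\<^esub> p = \<epsilon>"
proof (rule aut_eqI[of _ p])
  fix v assume "v \<in> V"
  then show "(b [^]\<^bsub>G\<^esub> p) v = \<epsilon> v"
  proof (induction v)
    case (Cons j w)
    then show ?case
      using pow_apply_Cons[of b j b w p] pow_apply_Cons[of b j "a [^]\<^bsub>G\<^esub> \<alpha> (j + 1)" w p] a_int_pow_p
      by (cases "j = p - 1") auto
  qed simp
qed auto

lemma c_pow_p: "c [^]\<^bsub>G\<^esub> p = \<epsilon>"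
proof (rule aut_eqI[of _ p])
  fix v assume "v \<in> V"
  then show "(c [^]\<^bsub>G\<^esub> p) v = \<epsilon> v"
  proof (induction v)
    case (Cons j w)
    then show ?case
      using pow_apply_Cons[of c j c w p] pow_apply_Cons[of c j "a [^]\<^bsub>G\<^esub> \<alpha> j" w p] a_int_pow_p
      by (cases "j = 0") auto
  qed simp
qed auto

fun gen_aut where
  "gen_aut GenA = a" | "gen_aut GenB = b" | "gen_aut GenC = c"

primrec word_aut :: "generator list \<Rightarrow> nat list \<Rightarrow> nat list" where
  "word_aut [] = \<epsilon>"
| "word_aut (x # w) = gen_aut x \<odot> word_aut w"

lemma gen_aut_closed [simp]: "gen_aut x \<in> carrier G" by (cases x) auto

lemma word_aut_closed [simp]: "word_aut w \<in> carrier G" by (induction w) auto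

lemma word_aut_append: "word_aut (u @ w) = word_aut u \<odot> word_aut w"
  by (induction u) (auto simp: m_assoc)

lemma word_aut_replicate: "word_aut (replicate n x) = gen_aut x [^]\<^bsub>G\<^esub> n"
  by (induction n) (simp_all add: nat_pow_Suc2[symmetric])

lemma gen_aut_pow_p: "gen_aut x [^]\<^bsub>G\<^esub> p = \<epsilon>"
  by (cases x) (simp_all add: a_pow_p b_pow_p c_pow_p)

text \<open>As every generator has order dividing \<open>p\<close>, words need no inverse letters: the inverse of a letter
  is its power \<open>p - 1\<close>. This preserves letter counts modulo \<open>p\<close> up to sign.\<close>

definition inv_word :: "generator list \<Rightarrow> generator list" where
  "inv_word w = concat (map (replicate (p - 1)) (rev w))"

lemma inv_word_simps [simp]: "inv_word [] = []" "inv_word (x # w) = inv_word w @ replicate (p - 1) x"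
  by (simp_all add: inv_word_def)

lemma word_aut_inv_word: "word_aut (inv_word w) = inv\<^bsub>G\<^esub> (word_aut w)"
proof (induction w)
  case (Cons x w)
  have "gen_aut x [^]\<^bsub>G\<^esub> (p - 1) \<odot> gen_aut x = \<epsilon>"
    using gen_aut_pow_p[of x] p_pos nat_pow_Suc[of "gen_aut x" "p - 1"] by simp
  then have "gen_aut x [^]\<^bsub>G\<^esub> (p - 1) = inv\<^bsub>G\<^esub> gen_aut x" by (intro inv_equality[symmetric]) auto
  then show ?case using Cons by (simp add: word_aut_append word_aut_replicate inv_mult_group)
qed simp

lemma count_replicate [simp]: "count_list (replicate n y) x = (if x = y then n else 0)"
  by (induction n) auto

lemma count_inv_word: "count_list (inv_word w) x = (p - 1) * count_list w x"
  by (induction w) auto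

abbreviation \<Gamma> where "\<Gamma> \<equiv> EGS_group p \<alpha>"

lemma \<Gamma>_subgroup: "subgroup \<Gamma> G"
  unfolding EGS_group_def by (rule generate_is_subgroup) auto

lemma \<Gamma>_eq_words: "\<Gamma> = range word_aut"
proof
  show "\<Gamma> \<subseteq> range word_aut"
  proof
    fix g assume "g \<in> \<Gamma>"
    then have "\<exists>w. g = word_aut w" unfolding EGS_group_def
    proof (induction rule: generate.induct)
      case one show ?case by (intro exI[of _ "[]"]) simp
    next
      case (incl h)
      then obtain x where "h = gen_aut x" using gen_aut.simps by (metis insertE singletonD)
      then show ?case by (intro exI[of _ "[x]"]) simp
    next
      case (inv h)
      then obtain x where "h = gen_aut x" using gen_aut.simps by (metis insertE singletonD)
      then show ?case by (intro exI[of _ "inv_word [x]"]) (simp only: word_aut_inv_word, simp)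
    next
      case (eng h1 h2)
      then show ?case using word_aut_append by metis
    qed
    then show "g \<in> range word_aut" by blast
  qed
  show "range word_aut \<subseteq> \<Gamma>"
  proof
    fix g assume "g \<in> range word_aut"
    then obtain w where "g = word_aut w" by blast
    moreover have "gen_aut x \<in> \<Gamma>" for x
      unfolding EGS_group_def by (rule generate.incl) (cases x, auto)
    then have "word_aut w \<in> \<Gamma>"
      by (induction w) (auto intro: subgroup.one_closed[OF \<Gamma>_subgroup] subgroup.m_closed[OF \<Gamma>_subgroup])
    ultimately show "g \<in> \<Gamma>" by simp
  qed
qed

section \<open>The exponent sum of \<open>c\<close> modulo \<open>p\<close>\<close>

text \<open>The word that describes how \<open>w\<close> acts below the vertex \<open>k\<close> of the first level. Each letter \<open>b\<close> or
  \<open>c\<close> of \<open>w\<close> survives as such a letter below one vertex, and becomes a power of \<open>a\<close> below the others.\<close>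

primrec section_word :: "nat \<Rightarrow> generator list \<Rightarrow> generator list" where
  "section_word k [] = []"
| "section_word k (x # w) =
    (case x of
       GenA \<Rightarrow> section_word ((k + 1) mod p) w
     | GenB \<Rightarrow> (if k = p - 1 then [GenB] else replicate (nat (\<alpha> (k + 1))) GenA) @ section_word k w
     | GenC \<Rightarrow> (if k = 0 then [GenC] else replicate (nat (\<alpha> k)) GenA) @ section_word k w)"

lemma section_word_apply:
  assumes "k < p" "v \<in> V"
  shows "word_aut w (k # v) = ((k + count_list w GenA) mod p) # word_aut (section_word k w) v"
  using assms
proof (induction w arbitrary: k v)
  case (Cons x w)
  have nat_pow: "a [^]\<^bsub>G\<^esub> nat m = a [^]\<^bsub>G\<^esub> m" if "0 \<le> m" for m :: int using pow_nat[OF that] .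
  show ?case
  proof (cases x)
    case GenA
    then show ?thesis using Cons p_pos by (simp add: mod_add_left_eq)
  next
    case GenB
    then show ?thesis using Cons \<alpha>_range[of "k + 1"] p_pos
      by (auto simp: word_aut_append word_aut_replicate nat_pow)
  next
    case GenC
    then show ?thesis using Cons \<alpha>_range[of k] p_pos
      by (auto simp: word_aut_append word_aut_replicate nat_pow)
  qed
qed simp

lemma sum_count_sections:
  assumes "x \<noteq> GenA"
  shows "(\<Sum>k<p. count_list (section_word k w) x) = count_list w x"
proof (induction w)
  case (Cons y w)
  show ?case
  proof (cases y)
    case GenA
    then show ?thesis
      using Cons assms sum.reindex_bij_betw[OF Suc_mod_bij, of "\<lambda>k. count_list (section_word k w) x"] by simp
  next
    case GenB
    then have "(\<Sum>k<p. count_list (section_word k (y # w)) x) =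
      (\<Sum>k<p. (if k = p - 1 then if x = GenB then 1 else 0 else 0) + count_list (section_word k w) x)"
      using assms by (intro sum.cong) auto
    then show ?thesis using Cons GenB p_pos by (simp add: sum.distrib)
  next
    case GenC
    then have "(\<Sum>k<p. count_list (section_word k (y # w)) x) =
      (\<Sum>k<p. (if k = 0 then if x = GenC then 1 else 0 else 0) + count_list (section_word k w) x)"
      using assms by (intro sum.cong) auto
    then show ?thesis using Cons GenC p_pos by (simp add: sum.distrib)
  qed
qed simp

lemma count_section_le:
  "k < p \<Longrightarrow> x \<noteq> GenA \<Longrightarrow> count_list (section_word k w) x \<le> count_list w x"
  using member_le_sum[of k "{..<p}" "\<lambda>k. count_list (section_word k w) x"] sum_count_sections[of x w] by simp

definition directed_length :: "generator list \<Rightarrow> nat" where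
  "directed_length w = count_list w GenB + count_list w GenC"

lemma directed_length_section_le: "k < p \<Longrightarrow> directed_length (section_word k w) \<le> directed_length w"
  unfolding directed_length_def using count_section_le by (simp add: add_mono)

text \<open>If all directed letters of \<open>w\<close> move into the section at \<open>k\<close>, then no power of \<open>a\<close> moves there,
  and the vertex \<open>k + t\<close> receives \<open>a\<close> to the power \<open>\<alpha> t\<close> from each of them: the
  section of \<open>b\<close> at \<open>p - 1 + t\<close>, taken modulo \<open>p\<close>, and the section of \<open>c\<close> at \<open>t\<close> are both \<open>a\<close> to the power \<open>\<alpha> t\<close>.\<close>

lemma concentrated_sections:
  assumes "k < p" "directed_length (section_word k w) = directed_length w"
  shows "GenA \<notin> set (section_word k w)"
    and "1 \<le> t \<Longrightarrow> t < p \<Longrightarrow> section_word ((k + t) mod p) w = replicate (directed_length w * nat (\<alpha> t)) GenA"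
proof -
  have "GenA \<notin> set (section_word k w) \<and>
    (1 \<le> t \<longrightarrow> t < p \<longrightarrow> section_word ((k + t) mod p) w = replicate (directed_length w * nat (\<alpha> t)) GenA)"
    using assms
  proof (induction w arbitrary: k)
    case (Cons x w)
    show ?case
    proof (cases x)
      case GenA
      have "((k + t) mod p + 1) mod p = ((k + 1) mod p + t) mod p" by (simp add: mod_simps add_ac)
      then show ?thesis
        using Cons.IH[of "(k + 1) mod p"] Cons.prems p_pos GenA by (simp add: directed_length_def)
    next
      case GenB
      have k: "k = p - 1"
      proof (rule ccontr)
        assume "k \<noteq> p - 1"
        then have "directed_length (section_word k w) = Suc (directed_length w)"
          using Cons.prems GenB by (simp add: directed_length_def)
        then show False using directed_length_section_le[OF Cons.prems(1), of w] by simp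
      qed
      moreover have "directed_length (section_word k w) = directed_length w"
        using Cons.prems GenB k by (simp add: directed_length_def)
      moreover have "1 \<le> t \<Longrightarrow> t < p \<Longrightarrow> (p - 1 + t) mod p = t - 1"
        using p_pos by (simp add: mod_if)
      ultimately show ?thesis using Cons.IH[of k] Cons.prems GenB
        by (auto simp: replicate_add[symmetric] directed_length_def algebra_simps)
    next
      case GenC
      have k: "k = 0"
      proof (rule ccontr)
        assume "k \<noteq> 0"
        then have "directed_length (section_word k w) = Suc (directed_length w)"
          using Cons.prems GenC by (simp add: directed_length_def)
        then show False using directed_length_section_le[OF Cons.prems(1), of w] by simp
      qed
      moreover have "directed_length (section_word k w) = directed_length w"
        using Cons.prems GenC k by (simp add: directed_length_def)
      ultimately show ?thesis using Cons.IH[of k] Cons.prems GenC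
        by (auto simp: replicate_add[symmetric] directed_length_def algebra_simps)
    qed
  qed (simp add: directed_length_def)
  then show "GenA \<notin> set (section_word k w)"
    and "1 \<le> t \<Longrightarrow> t < p \<Longrightarrow> section_word ((k + t) mod p) w = replicate (directed_length w * nat (\<alpha> t)) GenA"
    by auto
qed

lemma section_word_without_GenA:
  assumes "GenA \<notin> set w" "k < p"
  shows "directed_length (section_word k w) =
    (if k = p - 1 then count_list w GenB else if k = 0 then count_list w GenC else 0)"
  using assms
proof (induction w)
  case (Cons x w)
  then show ?case using p_pos by (cases x) (auto simp: directed_length_def)
qed (simp add: directed_length_def)

lemma section_word_trivial:
  assumes "word_aut w = \<epsilon>" "k < p"
  shows "word_aut (section_word k w) = \<epsilon>"
proof (rule aut_eqI[of _ p])
  fix v assume "v \<in> V"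
  then show "word_aut (section_word k w) v = \<epsilon> v"
    using section_word_apply[OF assms(2), of v w] assms by simp
qed auto

lemma \<alpha>_nonzero: "\<exists>t\<ge>1. t < p \<and> \<not> int p dvd \<alpha> t"
proof -
  obtain i where i: "1 \<le> i" "i < p" "\<alpha> i \<noteq> \<alpha> (p - i)" using \<alpha>_nonsym by blast
  have "1 \<le> p - i" "p - i < p" using i by auto
  then have "\<not> int p dvd \<alpha> i \<or> \<not> int p dvd \<alpha> (p - i)"
    using i \<alpha>_range[of i] \<alpha>_range[of "p - i"] by (metis dvd_imp_mod_0 mod_pos_pos_trivial)
  then show ?thesis using i \<open>1 \<le> p - i\<close> \<open>p - i < p\<close> by blast
qed

text \<open>The sections of a trivial word are trivial, and the number of letters \<open>c\<close> in the word is the sum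
  of the numbers in the sections. So induction on the directed length applies unless some section
  \<open>u\<close> contains all \<open>n\<close> directed letters. In that case another section is \<open>a\<close> to the power
  \<open>n * \<alpha> t\<close> with \<open>\<alpha> t\<close> nonzero, whence \<open>p\<close> divides \<open>n\<close>; this settles the case that
  \<open>u\<close> has no letter \<open>b\<close>. If both \<open>b\<close> and \<open>c\<close> occur in \<open>u\<close>, then, \<open>u\<close> having no letter \<open>a\<close>, they are sent
  to different vertices, \<open>p - 1\<close> and \<open>0\<close>, and the sections of \<open>u\<close> are shorter.\<close>

theorem count_GenC_of_trivial_word:
  assumes "word_aut w = \<epsilon>"
  shows "p dvd count_list w GenC"
  using assms
proof (induction "directed_length w" arbitrary: w rule: less_induct)
  case less
  have split: "p dvd count_list u GenC"
    if "word_aut u = \<epsilon>" "directed_length u = directed_length w"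
      "\<And>k. k < p \<Longrightarrow> directed_length (section_word k u) < directed_length u" for u
  proof -
    have "p dvd (\<Sum>k<p. count_list (section_word k u) GenC)"
      using that less.hyps section_word_trivial by (intro dvd_sum) auto
    then show ?thesis using sum_count_sections[of GenC u] by simp
  qed
  show ?case
  proof (cases "\<forall>k<p. directed_length (section_word k w) < directed_length w")
    case True then show ?thesis using split less.prems by blast
  next
    case False
    then obtain k where k: "k < p" and full: "directed_length (section_word k w) = directed_length w"
      using directed_length_section_le by (meson le_neq_implies_less)
    define u where "u = section_word k w"
    have u: "word_aut u = \<epsilon>" using section_word_trivial less.prems k u_def by blast
    have counts: "count_list u GenC = count_list w GenC"
      using full count_section_le[OF k, of GenB w] count_section_le[OF k, of GenC w]
      by (simp add: u_def directed_length_def)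
    have noA: "GenA \<notin> set u" using concentrated_sections(1)[OF k full] by (simp add: u_def)
    obtain t where t: "1 \<le> t" "t < p" "\<not> int p dvd \<alpha> t" using \<alpha>_nonzero by blast
    have "word_aut (section_word ((k + t) mod p) w) = \<epsilon>"
      using section_word_trivial[OF less.prems] p_pos by simp
    then have "p dvd directed_length w * nat (\<alpha> t)"
      using concentrated_sections(2)[OF k full t(1,2)]
      by (simp add: word_aut_replicate a_pow_eq_one_iff)
    moreover have "\<not> p dvd nat (\<alpha> t)" using t \<alpha>_range[of t] by (metis int_dvd_int_iff int_nat_eq)
    ultimately have n: "p dvd directed_length w" using p_prime by (simp add: prime_dvd_mult_iff)
    consider "count_list u GenC = 0" | "count_list u GenB = 0" | "count_list u GenB > 0" "count_list u GenC > 0"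
      by blast
    then show ?thesis
    proof cases
      case 1 then show ?thesis using counts by simp
    next
      case 2 then show ?thesis using counts full n by (simp add: u_def directed_length_def)
    next
      case 3
      then have "directed_length (section_word l u) < directed_length u" if "l < p" for l
        using section_word_without_GenA[OF noA that] by (simp add: directed_length_def)
      then show ?thesis using split[OF u] full counts u_def by simp
    qed
  qed
qed

section \<open>Elements that fix the first level\<close>

abbreviation P where "P \<equiv> int p"

text \<open>The defining vector as a function on the residues modulo \<open>p\<close>; its argument will be the
  difference of a coordinate and the coordinate of a directed entry.\<close>

definition \<beta> :: "int \<Rightarrow> int" where
  "\<beta> k = \<alpha> (nat (k mod P))"

lemma \<beta>_periodic: "P dvd k - l \<Longrightarrow> \<beta> k = \<beta> l"
  unfolding \<beta>_def by (rule arg_cong[where f = "\<lambda>m. \<alpha> (nat m)"]) (simp add: mod_eq_dvd_iff)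

lemmas tuple_closed' [simp] = tuple_closed[of _ p]

definition periodic :: "(int \<Rightarrow> 'z) \<Rightarrow> bool" where
  "periodic f \<longleftrightarrow> (\<forall>k l. P dvd k - l \<longrightarrow> f k = f l)"

lemma periodicD: "periodic f \<Longrightarrow> P dvd k - l \<Longrightarrow> f k = f l"
  by (auto simp: periodic_def)

lemma periodic_combine:
  assumes "periodic f" "periodic g" shows "periodic (\<lambda>k. h (f k) (g k))"
  unfolding periodic_def using assms by (intro allI impI arg_cong2[where f = h] periodicD)

lemma tuple_cong: "(\<And>k. 0 \<le> k \<Longrightarrow> k < P \<Longrightarrow> f k = g k) \<Longrightarrow> tuple p f = tuple p g"
  by (auto simp: tuple_def fun_eq_iff split: list.splits)

lemma tuple_mult:
  assumes "\<And>k. f k \<in> carrier G" "\<And>k. g k \<in> carrier G"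
  shows "tuple p f \<odot> tuple p g = tuple p (\<lambda>k. f k \<odot> g k)"
proof (rule aut_eqI[of _ p])
  fix v assume "v \<in> V"
  then show "(tuple p f \<odot> tuple p g) v = tuple p (\<lambda>k. f k \<odot> g k) v"
    using assms by (cases v) auto
qed (use assms in simp_all)

lemma tuple_one: "tuple p (\<lambda>k. \<epsilon>) = \<epsilon>"
proof (rule aut_eqI[of _ p])
  fix v assume "v \<in> V"
  then show "tuple p (\<lambda>k. \<epsilon>) v = \<epsilon> v" by (cases v) auto
qed (auto intro: tuple_closed)

lemma tuple_inv:
  assumes "\<And>k. f k \<in> carrier G"
  shows "inv\<^bsub>G\<^esub> (tuple p f) = tuple p (\<lambda>k. inv\<^bsub>G\<^esub> (f k))"
  using assms by (intro inv_equality) (auto simp: tuple_mult tuple_one intro: tuple_closed)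

lemma tuple_shift:
  assumes f: "\<And>k. f k \<in> carrier G" and per: "periodic f"
  shows "tuple p f \<odot> a = a \<odot> tuple p (\<lambda>k. f (k - 1))"
proof (rule aut_eqI[of _ p])
  fix v assume v: "v \<in> V"
  show "(tuple p f \<odot> a) v = (a \<odot> tuple p (\<lambda>k. f (k - 1))) v"
  proof (cases v)
    case (Cons j w)
    have "f (int ((j + 1) mod p) - 1) = f (int j)"
      by (rule periodicD[OF per]) (simp add: zmod_int mod_eq_dvd_iff[symmetric] mod_simps)
    then show ?thesis using v Cons f p_pos by simp
  qed simp
qed (use f in simp_all)

text \<open>Conjugation by \<open>a\<close> shifts the coordinates.\<close>

lemma shifted_tuple_mem:
  assumes N: "subgroup N G" "\<And>x. x \<in> N \<Longrightarrow> inv\<^bsub>G\<^esub> a \<odot> x \<odot> a \<in> N" "\<And>x. x \<in> N \<Longrightarrow> a \<odot> x \<odot> inv\<^bsub>G\<^esub> a \<in> N"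
    and f: "\<And>k. f k \<in> carrier G" and per: "periodic f" and mem: "tuple p f \<in> N"
  shows "tuple p (\<lambda>k. f (k - j)) \<in> N"
proof (induction j rule: int_induct[where k = 0])
  case base show ?case using mem by simp
next
  case (step1 j)
  let ?x = "tuple p (\<lambda>k. f (k - j))" and ?y = "tuple p (\<lambda>k. f (k - (j + 1)))"
  have xy: "?x \<in> carrier G" "?y \<in> carrier G" using f by (auto intro: tuple_closed)
  have "periodic (\<lambda>k. f (k - j))" using per by (simp add: periodic_def)
  then have "?x \<odot> a = a \<odot> ?y"
    using tuple_shift[of "\<lambda>k. f (k - j)"] f by (simp add: algebra_simps)
  then have "?y = inv\<^bsub>G\<^esub> a \<odot> ?x \<odot> a" using xy by (simp add: m_assoc inv_solve_left)
  then show ?case using N(2)[OF step1(2)] by simp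
next
  case (step2 j)
  let ?x = "tuple p (\<lambda>k. f (k - j))" and ?y = "tuple p (\<lambda>k. f (k - (j - 1)))"
  have xy: "?x \<in> carrier G" "?y \<in> carrier G" using f by (auto intro: tuple_closed)
  have "periodic (\<lambda>k. f (k - (j - 1)))" using per by (simp add: periodic_def)
  then have "?y \<odot> a = a \<odot> ?x"
    using tuple_shift[of "\<lambda>k. f (k - (j - 1))"] f by (simp add: algebra_simps)
  then have "?y = a \<odot> ?x \<odot> inv\<^bsub>G\<^esub> a" using xy by (simp add: inv_solve_right)
  then show ?case using N(3)[OF step2(2)] by simp
qed

text \<open>The sections of the conjugate of \<open>b\<close> or \<open>c\<close> by a power of \<open>a\<close> that has its directed entry \<open>x\<close> at
  the coordinate \<open>j\<close>.\<close>

definition gtuple :: "(nat list \<Rightarrow> nat list) \<Rightarrow> int \<Rightarrow> int \<Rightarrow> nat list \<Rightarrow> nat list" where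
  "gtuple x j k = (if P dvd k - j then x else a [^]\<^bsub>G\<^esub> \<beta> (k - j))"

definition single :: "int \<Rightarrow> (nat list \<Rightarrow> nat list) \<Rightarrow> int \<Rightarrow> nat list \<Rightarrow> nat list" where
  "single j g k = (if P dvd k - j then g else \<epsilon>)"

lemma dvd_shift_iff: "P dvd k - l \<Longrightarrow> P dvd k - j \<longleftrightarrow> P dvd l - j"
  using dvd_add_right_iff[of P "k - l" "l - j"] by simp

lemma periodic_gtuple: "periodic (gtuple x j)"
  unfolding periodic_def gtuple_def
proof (intro allI impI)
  fix k l assume kl: "P dvd k - l"
  then have "\<beta> (k - j) = \<beta> (l - j)" by (intro \<beta>_periodic) simp
  then show "(if P dvd k - j then x else a [^]\<^bsub>G\<^esub> \<beta> (k - j)) = (if P dvd l - j then x else a [^]\<^bsub>G\<^esub> \<beta> (l - j))"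
    using dvd_shift_iff[OF kl, of j] by simp
qed

lemma periodic_single: "periodic (single j g)"
  unfolding periodic_def single_def using dvd_shift_iff by (intro allI impI) (rule if_cong, auto)

lemma gtuple_closed [simp]: "x \<in> carrier G \<Longrightarrow> gtuple x j k \<in> carrier G"
  by (simp add: gtuple_def)

lemma single_closed [simp]: "g \<in> carrier G \<Longrightarrow> single j g k \<in> carrier G"
  by (simp add: single_def)

lemma dvd_small_iff: "0 \<le> k \<Longrightarrow> k < P \<Longrightarrow> 0 \<le> l \<Longrightarrow> l < P \<Longrightarrow> P dvd k - l \<longleftrightarrow> k = l"
  by (simp add: mod_eq_dvd_iff[symmetric])

lemma b_tuple: "b = tuple p (gtuple b (- 1))"
proof (rule aut_eqI[of _ p])
  fix v assume v: "v \<in> V"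
  show "b v = tuple p (gtuple b (- 1)) v"
  proof (cases v)
    case (Cons j w)
    have "P dvd int (j + 1) \<longleftrightarrow> j = p - 1"
    proof
      assume "P dvd int (j + 1)"
      then have "p \<le> j + 1" by (intro dvd_imp_le) (simp_all only: int_dvd_int_iff)
      then show "j = p - 1" using v Cons by auto
    next
      assume "j = p - 1"
      then have "j + 1 = p" using p_pos by simp
      then show "P dvd int (j + 1)" by (simp only: dvd_refl)
    qed
    then have "P dvd int j + 1 \<longleftrightarrow> j = p - 1" by (simp add: add.commute)
    moreover have "j \<noteq> p - 1 \<Longrightarrow> \<beta> (int j + 1) = \<alpha> (j + 1)"
      using v Cons by (auto simp: \<beta>_def nat_add_distrib)
    ultimately show ?thesis using v Cons by (simp add: gtuple_def)
  qed simp
qed simp_all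

lemma c_tuple: "c = tuple p (gtuple c 0)"
proof (rule aut_eqI[of _ p])
  fix v assume v: "v \<in> V"
  show "c v = tuple p (gtuple c 0) v"
  proof (cases v)
    case (Cons j w)
    have "P dvd int j \<longleftrightarrow> j = 0" using v Cons by (auto dest: dvd_imp_le)
    moreover have "\<beta> (int j) = \<alpha> j" using v Cons by (simp add: \<beta>_def)
    ultimately show ?thesis using v Cons by (simp add: gtuple_def)
  qed simp
qed simp_all

lemma \<Gamma>_carrier [simp]: "g \<in> \<Gamma> \<Longrightarrow> g \<in> carrier G"
  using subgroup.mem_carrier[OF \<Gamma>_subgroup] .
lemma \<Gamma>_mult [simp]: "g \<in> \<Gamma> \<Longrightarrow> h \<in> \<Gamma> \<Longrightarrow> g \<odot> h \<in> \<Gamma>"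
  using subgroup.m_closed[OF \<Gamma>_subgroup] .
lemma \<Gamma>_inv [simp]: "g \<in> \<Gamma> \<Longrightarrow> inv\<^bsub>G\<^esub> g \<in> \<Gamma>"
  using subgroup.m_inv_closed[OF \<Gamma>_subgroup] .
lemma \<Gamma>_one [simp]: "\<epsilon> \<in> \<Gamma>"
  using subgroup.one_closed[OF \<Gamma>_subgroup] .
lemma \<Gamma>_gens [simp]: "a \<in> \<Gamma>" "b \<in> \<Gamma>" "c \<in> \<Gamma>"
  unfolding EGS_group_def by (auto intro: generate.incl)
lemma \<Gamma>_int_pow [simp]: "g \<in> \<Gamma> \<Longrightarrow> g [^]\<^bsub>G\<^esub> (n::int) \<in> \<Gamma>"
  using subgroup_int_pow_closed[OF \<Gamma>_subgroup] .

lemma gtuple_shift: "gtuple x j (k - i) = gtuple x (j + i) k"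
  by (simp add: gtuple_def algebra_simps)

lemma single_shift: "single j g (k - i) = single (j + i) g k"
  by (simp add: single_def algebra_simps)

lemma gtuple_mem:
  assumes "tuple p (gtuple x i) \<in> \<Gamma>" "x \<in> carrier G"
  shows "tuple p (gtuple x j) \<in> \<Gamma>"
  using shifted_tuple_mem[OF \<Gamma>_subgroup _ _ _ periodic_gtuple[of x i], of "j - i"] assms
  by (simp add: gtuple_closed gtuple_shift)

lemma b_gtuple_mem: "tuple p (gtuple b j) \<in> \<Gamma>"
  using gtuple_mem[of b "-1"] b_tuple by simp

lemma c_gtuple_mem: "tuple p (gtuple c j) \<in> \<Gamma>"
  using gtuple_mem[of c 0] c_tuple by simp

section \<open>Branching over the derived subgroup\<close>

abbreviation D where "D \<equiv> derived G \<Gamma>"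

lemma D_subgroup: "subgroup D G"
  by (rule derived_is_subgroup) auto

lemma D_subset: "D \<subseteq> \<Gamma>"
  by (rule derived_incl[OF _ \<Gamma>_subgroup]) simp

lemma D_comm: "g \<in> \<Gamma> \<Longrightarrow> h \<in> \<Gamma> \<Longrightarrow> g \<odot> h \<odot> inv\<^bsub>G\<^esub> g \<odot> inv\<^bsub>G\<^esub> h \<in> D"
  unfolding derived_def by (rule generate.incl) auto

lemma D_conj:
  assumes "g \<in> \<Gamma>" "h \<in> D" shows "g \<odot> h \<odot> inv\<^bsub>G\<^esub> g \<in> D"
  using normal.inv_op_closed2[OF derived_subgroup_is_normal[OF \<Gamma>_subgroup], of g h] assms
  by (simp add: m_inv_consistent[OF \<Gamma>_subgroup])

lemma D_conj':
  assumes "g \<in> \<Gamma>" "h \<in> D" shows "inv\<^bsub>G\<^esub> g \<odot> h \<odot> g \<in> D"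
  using D_conj[of "inv\<^bsub>G\<^esub> g" h] assms by simp

lemma single_mem_shift:
  assumes "tuple p (single i g) \<in> D" "g \<in> carrier G"
  shows "tuple p (single j g) \<in> D"
  using shifted_tuple_mem[OF D_subgroup D_conj' D_conj _ periodic_single[of i g], of "j - i"] assms
  by (simp add: single_closed single_shift)

definition tuples_in :: "(nat list \<Rightarrow> nat list) set \<Rightarrow> (int \<Rightarrow> nat list \<Rightarrow> nat list) set" where
  "tuples_in N = {f. periodic f \<and> (\<forall>k. f k \<in> \<Gamma>) \<and> tuple p f \<in> N}"

lemma tuples_inD:
  "f \<in> tuples_in N \<Longrightarrow> periodic f" "f \<in> tuples_in N \<Longrightarrow> f k \<in> \<Gamma>" "f \<in> tuples_in N \<Longrightarrow> tuple p f \<in> N"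
  by (auto simp: tuples_in_def)

lemma tuples_in_mult:
  assumes "subgroup N G" "f \<in> tuples_in N" "g \<in> tuples_in N"
  shows "(\<lambda>k. f k \<odot> g k) \<in> tuples_in N"
proof -
  have "tuple p f \<odot> tuple p g \<in> N"
    using subgroup.m_closed assms(1) tuples_inD(3)[OF assms(2)] tuples_inD(3)[OF assms(3)] .
  moreover have "periodic (\<lambda>k. f k \<odot> g k)"
    by (rule periodic_combine[OF tuples_inD(1)[OF assms(2)] tuples_inD(1)[OF assms(3)]])
  moreover have "f k \<in> \<Gamma>" "g k \<in> \<Gamma>" for k
    using tuples_inD(2)[OF assms(2)] tuples_inD(2)[OF assms(3)] by simp_all
  ultimately show ?thesis by (simp add: tuples_in_def tuple_mult)
qed

lemma tuples_in_inv:
  assumes "subgroup N G" "f \<in> tuples_in N"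
  shows "(\<lambda>k. inv\<^bsub>G\<^esub> (f k)) \<in> tuples_in N"
proof -
  have "inv\<^bsub>G\<^esub> (tuple p f) \<in> N" using subgroup.m_inv_closed assms(1) tuples_inD(3)[OF assms(2)] .
  moreover have "periodic (\<lambda>k. inv\<^bsub>G\<^esub> (f k))"
    using periodic_combine[of f f "\<lambda>x _. inv\<^bsub>G\<^esub> x"] tuples_inD(1)[OF assms(2)] by simp
  moreover have "f k \<in> \<Gamma>" for k using tuples_inD(2)[OF assms(2)] .
  ultimately show ?thesis by (simp add: tuples_in_def tuple_inv)
qed

lemma tuples_in_one: "subgroup N G \<Longrightarrow> (\<lambda>k. \<epsilon>) \<in> tuples_in N"
  by (simp add: tuples_in_def tuple_one periodic_def subgroup.one_closed)

lemma gtuple_tuples_in: "gtuple b j \<in> tuples_in \<Gamma>" "gtuple c j \<in> tuples_in \<Gamma>"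
proof -
  have "gtuple x j k \<in> \<Gamma>" if "x \<in> \<Gamma>" for x k using that by (simp add: gtuple_def)
  then show "gtuple b j \<in> tuples_in \<Gamma>" "gtuple c j \<in> tuples_in \<Gamma>"
    unfolding tuples_in_def using periodic_gtuple b_gtuple_mem c_gtuple_mem \<Gamma>_gens by blast+
qed

text \<open>The group is self-replicating: the first coordinates of tuples form a subgroup, which contains
  the directed entries \<open>b\<close> and \<open>c\<close> and a nontrivial power of \<open>a\<close>.\<close>

lemma tuple_with_coordinate:
  assumes "g \<in> \<Gamma>" obtains f where "f \<in> tuples_in \<Gamma>" "f 0 = g"
proof -
  define N where "N = (\<lambda>f. f 0) ` tuples_in \<Gamma>"
  have N: "subgroup N G"
  proof (rule subgroupI)
    show "N \<subseteq> carrier G" using \<Gamma>_carrier tuples_inD(2) unfolding N_def by blast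
    show "N \<noteq> {}" using tuples_in_one[OF \<Gamma>_subgroup] by (auto simp: N_def)
    show "inv\<^bsub>G\<^esub> x \<in> N" if "x \<in> N" for x
      using that tuples_in_inv[OF \<Gamma>_subgroup] by (force simp: N_def)
    show "x \<odot> y \<in> N" if "x \<in> N" "y \<in> N" for x y
      using that tuples_in_mult[OF \<Gamma>_subgroup] by (force simp: N_def)
  qed
  obtain t where t: "1 \<le> t" "t < p" "\<not> P dvd \<alpha> t" using \<alpha>_nonzero by blast
  have "gtuple b (- int t) 0 \<in> N" using gtuple_tuples_in by (auto simp: N_def)
  then have "a [^]\<^bsub>G\<^esub> \<alpha> t \<in> N"
    using t nat_dvd_not_less[of t p] by (simp add: gtuple_def \<beta>_def)
  moreover obtain m :: int where "(a [^]\<^bsub>G\<^esub> \<alpha> t) [^]\<^bsub>G\<^esub> m = a"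
  proof (rule int_pow_cancel[of a P "\<alpha> t"])
    show "coprime (\<alpha> t) P" using t p_prime by (simp add: coprime_commute prime_imp_coprime)
  qed (auto simp: int_pow_int a_pow_p)
  ultimately have "a \<in> N" using subgroup_int_pow_closed[OF N] by metis
  moreover have "b \<in> N"
    using gtuple_tuples_in(1)[of 0] unfolding N_def by (rule rev_image_eqI) (simp add: gtuple_def)
  moreover have "c \<in> N"
    using gtuple_tuples_in(2)[of 0] unfolding N_def by (rule rev_image_eqI) (simp add: gtuple_def)
  ultimately have "\<Gamma> \<subseteq> N"
    unfolding EGS_group_def by (intro generate_subgroup_incl[OF _ N]) auto
  then show thesis using assms that by (auto simp: N_def)
qed

text \<open>That \<open>R\<close> contains the derived subgroup is the goal of this section. The coordinate \<open>0\<close> could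
  be any other one, by \<open>single_mem_shift\<close>.\<close>

definition R where "R = {g \<in> \<Gamma>. tuple p (single 0 g) \<in> D}"

lemma single_mult: "x \<in> carrier G \<Longrightarrow> y \<in> carrier G \<Longrightarrow>
  tuple p (single j x) \<odot> tuple p (single j y) = tuple p (single j (x \<odot> y))"
  by (auto simp: tuple_mult single_closed intro!: tuple_cong) (simp add: single_def)

lemma single_inv: "x \<in> carrier G \<Longrightarrow>
  inv\<^bsub>G\<^esub> (tuple p (single j x)) = tuple p (single j (inv\<^bsub>G\<^esub> x))"
  by (auto simp: tuple_inv single_closed intro!: tuple_cong) (simp add: single_def)

lemma R_subgroup: "subgroup R G"
proof (rule subgroupI)
  show "R \<subseteq> carrier G" by (auto simp: R_def)
  have "tuple p (single 0 \<epsilon>) = tuple p (\<lambda>k. \<epsilon>)" by (rule tuple_cong) (simp add: single_def)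
  then have "\<epsilon> \<in> R" by (simp add: R_def tuple_one subgroup.one_closed[OF D_subgroup])
  then show "R \<noteq> {}" by blast
  show "inv\<^bsub>G\<^esub> x \<in> R" if "x \<in> R" for x
    using that subgroup.m_inv_closed[OF D_subgroup] by (auto simp: R_def single_inv[symmetric])
  show "x \<odot> y \<in> R" if "x \<in> R" "y \<in> R" for x y
    using that subgroup.m_closed[OF D_subgroup] by (auto simp: R_def single_mult[symmetric])
qed

abbreviation \<Gamma>G where "\<Gamma>G \<equiv> G\<lparr>carrier := \<Gamma>\<rparr>"

text \<open>To conjugate \<open>(r, 1, \<dots>, 1)\<close> into \<open>(g \<otimes> r \<otimes> inv g, 1, \<dots>, 1)\<close>, conjugate it by a tuple of the
  group with first coordinate \<open>g\<close>.\<close>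

lemma R_normal: "R \<lhd> \<Gamma>G"
proof -
  interpret \<Gamma>: group \<Gamma>G by (rule subgroup_imp_group[OF \<Gamma>_subgroup])
  have "subgroup R \<Gamma>G" by (rule subgroup_incl[OF R_subgroup \<Gamma>_subgroup]) (auto simp: R_def)
  moreover have "g \<odot> r \<odot> inv\<^bsub>G\<^esub> g \<in> R" if g: "g \<in> \<Gamma>" and r: "r \<in> R" for g r
  proof -
    obtain f where f: "f \<in> tuples_in \<Gamma>" "f 0 = g" using tuple_with_coordinate[OF g] .
    have fc: "f k \<in> carrier G" for k using tuples_inD(2)[OF f(1)] by simp
    have rc: "r \<in> carrier G" using r by (simp add: R_def)
    have "tuple p f \<odot> tuple p (single 0 r) \<odot> inv\<^bsub>G\<^esub> (tuple p f) \<in> D"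
      using D_conj[OF tuples_inD(3)[OF f(1)]] r by (simp add: R_def)
    also have "tuple p f \<odot> tuple p (single 0 r) \<odot> inv\<^bsub>G\<^esub> (tuple p f) =
      tuple p (\<lambda>k. f k \<odot> single 0 r k \<odot> inv\<^bsub>G\<^esub> (f k))"
      using fc rc by (simp add: tuple_mult tuple_inv single_closed)
    also have "\<dots> = tuple p (single 0 (g \<odot> r \<odot> inv\<^bsub>G\<^esub> g))"
    proof (rule tuple_cong)
      fix k assume "0 \<le> k" "k < P"
      show "f k \<odot> single 0 r k \<odot> inv\<^bsub>G\<^esub> (f k) = single 0 (g \<odot> r \<odot> inv\<^bsub>G\<^esub> g) k"
        using periodicD[OF tuples_inD(1)[OF f(1)], of k 0] f(2) fc[of k] by (simp add: single_def)
    qed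
    finally show ?thesis using g r by (simp add: R_def)
  qed
  ultimately show ?thesis
    by (intro \<Gamma>.normal_invI) (auto simp: m_inv_consistent[OF \<Gamma>_subgroup])
qed

lemma tuple_of_R:
  assumes "\<And>k. f k \<in> R" shows "tuple p f \<in> D"
proof -
  have fc: "f k \<in> carrier G" for k using assms by (auto simp: R_def)
  have "tuple p (\<lambda>k. if k < int n then f k else \<epsilon>) \<in> D" if "n \<le> p" for n
    using that
  proof (induction n)
    case 0
    have "tuple p (\<lambda>k. if k < int 0 then f k else \<epsilon>) = tuple p (\<lambda>k. \<epsilon>)" by (rule tuple_cong) simp
    then show ?case by (simp add: tuple_one subgroup.one_closed[OF D_subgroup])
  next
    case (Suc n)
    have "tuple p (single 0 (f (int n))) \<in> D" using assms by (simp add: R_def)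
    then have "tuple p (single (int n) (f (int n))) \<in> D" using single_mem_shift fc by blast
    then have "tuple p (\<lambda>k. if k < int n then f k else \<epsilon>) \<odot> tuple p (single (int n) (f (int n))) \<in> D"
      using Suc subgroup.m_closed[OF D_subgroup] by simp
    also have "tuple p (\<lambda>k. if k < int n then f k else \<epsilon>) \<odot> tuple p (single (int n) (f (int n))) =
      tuple p (\<lambda>k. (if k < int n then f k else \<epsilon>) \<odot> single (int n) (f (int n)) k)"
      using fc by (intro tuple_mult) (auto simp: single_closed)
    also have "\<dots> = tuple p (\<lambda>k. if k < int (Suc n) then f k else \<epsilon>)"
      using fc dvd_small_iff[of _ "int n"] Suc.prems by (intro tuple_cong) (auto simp: single_def)
    finally show ?case .
  qed
  from this[of p] have "tuple p (\<lambda>k. if k < P then f k else \<epsilon>) \<in> D" by simp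
  also have "tuple p (\<lambda>k. if k < P then f k else \<epsilon>) = tuple p f" by (rule tuple_cong) simp
  finally show ?thesis .
qed

lemma last_coordinate_in_R:
  assumes f: "f \<in> tuples_in D" and off: "\<And>k. \<not> P dvd k - j \<Longrightarrow> f k \<in> R"
  shows "f j \<in> R"
proof -
  have fc: "f k \<in> carrier G" for k using tuples_inD(2)[OF f] by simp
  define h where "h k = (if P dvd k - j then \<epsilon> else f k)" for k
  have hR: "h k \<in> R" for k using off subgroup.one_closed[OF R_subgroup] by (simp add: h_def)
  have hc: "h k \<in> carrier G" for k using fc by (simp add: h_def)
  have "tuple p f \<odot> inv\<^bsub>G\<^esub> (tuple p h) \<in> D"
    using tuples_inD(3)[OF f] tuple_of_R[OF hR] D_subgroup
    by (simp add: subgroup.m_closed subgroup.m_inv_closed)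
  also have "tuple p f \<odot> inv\<^bsub>G\<^esub> (tuple p h) = tuple p (\<lambda>k. f k \<odot> inv\<^bsub>G\<^esub> (h k))"
    using fc hc by (simp add: tuple_mult tuple_inv)
  also have "\<dots> = tuple p (single j (f j))"
    using fc periodicD[OF tuples_inD(1)[OF f]] by (intro tuple_cong) (auto simp: single_def h_def)
  finally show ?thesis using single_mem_shift[of j "f j" 0] fc tuples_inD(2)[OF f] by (simp add: R_def)
qed

definition \<pi> where "\<pi> g = R #>\<^bsub>\<Gamma>G\<^esub> g"

definition Q where "Q = \<Gamma>G Mod R"

lemma group_hom_\<pi>: "group_hom \<Gamma>G Q \<pi>"
proof -
  interpret N: normal R \<Gamma>G by (rule R_normal)
  show ?thesis
    using N.r_coset_hom_Mod N.factorgroup_is_group N.is_group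
    by (simp add: group_hom_def group_hom_axioms_def Q_def \<pi>_def[abs_def])
qed

lemma \<pi>_simps [simp]:
  "g \<in> \<Gamma> \<Longrightarrow> \<pi> g \<in> carrier Q"
  "g \<in> \<Gamma> \<Longrightarrow> h \<in> \<Gamma> \<Longrightarrow> \<pi> (g \<odot> h) = \<pi> g \<otimes>\<^bsub>Q\<^esub> \<pi> h"
  "g \<in> \<Gamma> \<Longrightarrow> \<pi> (inv\<^bsub>G\<^esub> g) = inv\<^bsub>Q\<^esub> (\<pi> g)"
  "\<pi> \<epsilon> = \<one>\<^bsub>Q\<^esub>"
  "g \<in> \<Gamma> \<Longrightarrow> \<pi> (g [^]\<^bsub>G\<^esub> (n::int)) = \<pi> g [^]\<^bsub>Q\<^esub> n"
proof -
  interpret h: group_hom \<Gamma>G Q \<pi> by (rule group_hom_\<pi>)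
  show "g \<in> \<Gamma> \<Longrightarrow> \<pi> g \<in> carrier Q" using h.hom_closed by simp
  show "g \<in> \<Gamma> \<Longrightarrow> h \<in> \<Gamma> \<Longrightarrow> \<pi> (g \<odot> h) = \<pi> g \<otimes>\<^bsub>Q\<^esub> \<pi> h" using h.hom_mult[of g h] by simp
  show "g \<in> \<Gamma> \<Longrightarrow> \<pi> (inv\<^bsub>G\<^esub> g) = inv\<^bsub>Q\<^esub> (\<pi> g)"
    using h.hom_inv[of g] by (simp add: m_inv_consistent[OF \<Gamma>_subgroup])
  show "\<pi> \<epsilon> = \<one>\<^bsub>Q\<^esub>" using h.hom_one by simp
  show "g \<in> \<Gamma> \<Longrightarrow> \<pi> (g [^]\<^bsub>G\<^esub> (n::int)) = \<pi> g [^]\<^bsub>Q\<^esub> n"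
    using h.hom_int_pow[of g n] by (simp add: int_pow_consistent[OF \<Gamma>_subgroup])
qed

lemma \<pi>_eq_one_iff: "g \<in> \<Gamma> \<Longrightarrow> \<pi> g = \<one>\<^bsub>Q\<^esub> \<longleftrightarrow> g \<in> R"
proof -
  assume g: "g \<in> \<Gamma>"
  interpret N: normal R \<Gamma>G by (rule R_normal)
  have "\<one>\<^bsub>Q\<^esub> = R" by (simp add: Q_def FactGroup_def)
  then show ?thesis
    using g N.coset_join1[of R g] N.coset_join2[of g R] N.subgroup_axioms N.subset
    by (auto simp: \<pi>_def)
qed

text \<open>An instance of \<open>gens_commute\<close>. If \<open>\<alpha>\<close> is asymmetric at \<open>i\<close>, the coordinate \<open>l * i\<close> is renamed
  to \<open>l\<close>, which is a permutation of the residues because \<open>i\<close> is invertible.\<close>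

lemma gens_commute_mod_R:
  "\<pi> a \<otimes>\<^bsub>Q\<^esub> \<pi> b = \<pi> b \<otimes>\<^bsub>Q\<^esub> \<pi> a"
  "\<pi> a \<otimes>\<^bsub>Q\<^esub> \<pi> c = \<pi> c \<otimes>\<^bsub>Q\<^esub> \<pi> a"
  "\<pi> b \<otimes>\<^bsub>Q\<^esub> \<pi> c = \<pi> c \<otimes>\<^bsub>Q\<^esub> \<pi> b"
proof -
  interpret h: group_hom \<Gamma>G Q \<pi> by (rule group_hom_\<pi>)
  obtain i where i: "1 \<le> i" "i < p" "\<alpha> i \<noteq> \<alpha> (p - i)" using \<alpha>_nonsym by blast
  have prime_P: "prime P" using p_prime by simp
  have cop: "coprime (int i) P"
  proof -
    have "\<not> p dvd i" using i by (auto dest: dvd_imp_le)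
    then show ?thesis using prime_imp_coprime[OF p_prime] coprime_commute by auto
  qed
  obtain m where m: "P dvd int i * m - 1"
    using cong_solve_coprime_int[OF cop] cong_iff_dvd_diff by blast
  have dvd_i: "P dvd k * int i - l * int i \<longleftrightarrow> P dvd k - l" for k l
    using cop by (simp add: left_diff_distrib[symmetric] coprime_commute coprime_dvd_mult_left_iff)
  define S where "S = (\<lambda>f l. \<pi> (f (l * int i))) ` tuples_in \<Gamma>"
  define E where "E = (\<lambda>f l. \<pi> (f (l * int i))) ` tuples_in D"
  have DG: "f \<in> tuples_in D \<Longrightarrow> f \<in> tuples_in \<Gamma>" for f using D_subset by (auto simp: tuples_in_def)
  have mem: "f k \<in> \<Gamma>" if "f \<in> tuples_in \<Gamma>" for f k using tuples_inD(2)[OF that] .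
  have pow_P: "\<pi> x [^]\<^bsub>Q\<^esub> P = \<one>\<^bsub>Q\<^esub>" if "x [^]\<^bsub>G\<^esub> p = \<epsilon>" "x \<in> \<Gamma>" for x
    using that \<pi>_simps(5)[of x P] by (simp add: int_pow_int)
  have gt: "(\<lambda>k. if P dvd k - j then \<pi> x else \<pi> a [^]\<^bsub>Q\<^esub> \<beta> ((k - j) * int i)) \<in> S"
    if "x \<in> \<Gamma>" "\<And>j. gtuple x j \<in> tuples_in \<Gamma>" for x j
    unfolding S_def
  proof (rule rev_image_eqI[OF that(2)[of "j * int i"]])
    show "(\<lambda>k. if P dvd k - j then \<pi> x else \<pi> a [^]\<^bsub>Q\<^esub> \<beta> ((k - j) * int i)) =
      (\<lambda>l. \<pi> (gtuple x (j * int i) (l * int i)))"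
      by (rule ext) (simp add: gtuple_def dvd_i left_diff_distrib)
  qed
  interpret commutator_tuples Q P "\<lambda>k. \<beta> (k * int i)" "\<pi> a" "\<pi> b" "\<pi> c" S E
  proof unfold_locales
    show "prime P" by (rule prime_P)
    show "P \<ge> 3" using p_ge_3 by simp
    show "\<beta> (k * int i) = \<beta> (l * int i)" if "P dvd k - l" for k l
      using that dvd_i by (intro \<beta>_periodic) simp
    show "\<pi> a \<in> carrier Q" "\<pi> b \<in> carrier Q" "\<pi> c \<in> carrier Q" by simp_all
    show "\<pi> a [^]\<^bsub>Q\<^esub> P = \<one>\<^bsub>Q\<^esub>" "\<pi> b [^]\<^bsub>Q\<^esub> P = \<one>\<^bsub>Q\<^esub>" using pow_P a_pow_p b_pow_p by simp_all
    show "F k \<in> carrier Q" if "F \<in> S" for F k using that mem by (auto simp: S_def)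
    show "F k = F l" if "F \<in> S" "P dvd k - l" for F k l
      using that dvd_i periodicD[OF tuples_inD(1)] by (auto simp: S_def intro!: arg_cong[of _ _ \<pi>])
    show "(\<lambda>k. F k \<otimes>\<^bsub>Q\<^esub> F' k) \<in> S" if "F \<in> S" "F' \<in> S" for F F'
    proof -
      obtain f f' where f: "f \<in> tuples_in \<Gamma>" "F = (\<lambda>l. \<pi> (f (l * int i)))"
        and f': "f' \<in> tuples_in \<Gamma>" "F' = (\<lambda>l. \<pi> (f' (l * int i)))"
          using \<open>F \<in> S\<close> \<open>F' \<in> S\<close> by (auto simp: S_def)
      show ?thesis unfolding S_def
        by (rule rev_image_eqI[OF tuples_in_mult[OF \<Gamma>_subgroup f(1) f'(1)]]) (use f f' mem in auto)
    qed
    show "(\<lambda>k. inv\<^bsub>Q\<^esub> (F k)) \<in> S" if "F \<in> S" for F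
    proof -
      obtain f where f: "f \<in> tuples_in \<Gamma>" "F = (\<lambda>l. \<pi> (f (l * int i)))"
        using \<open>F \<in> S\<close> by (auto simp: S_def)
      show ?thesis unfolding S_def
        by (rule rev_image_eqI[OF tuples_in_inv[OF \<Gamma>_subgroup f(1)]]) (use f mem in auto)
    qed
    show "E \<subseteq> S" using DG by (auto simp: E_def S_def)
    show "(\<lambda>k. \<one>\<^bsub>Q\<^esub>) \<in> E" unfolding E_def
      by (rule rev_image_eqI[OF tuples_in_one[OF D_subgroup]]) simp
    show "(\<lambda>k. F k \<otimes>\<^bsub>Q\<^esub> F' k) \<in> E" if "F \<in> E" "F' \<in> E" for F F'
    proof -
      obtain f f' where f: "f \<in> tuples_in D" "F = (\<lambda>l. \<pi> (f (l * int i)))"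
        and f': "f' \<in> tuples_in D" "F' = (\<lambda>l. \<pi> (f' (l * int i)))"
          using \<open>F \<in> E\<close> \<open>F' \<in> E\<close> by (auto simp: E_def)
      show ?thesis unfolding E_def
        by (rule rev_image_eqI[OF tuples_in_mult[OF D_subgroup f(1) f'(1)]]) (use f f' mem DG in auto)
    qed
    show "(\<lambda>k. inv\<^bsub>Q\<^esub> (F k)) \<in> E" if "F \<in> E" for F
    proof -
      obtain f where f: "f \<in> tuples_in D" "F = (\<lambda>l. \<pi> (f (l * int i)))"
        using \<open>F \<in> E\<close> by (auto simp: E_def)
      show ?thesis unfolding E_def
        by (rule rev_image_eqI[OF tuples_in_inv[OF D_subgroup f(1)]]) (use f mem DG in auto)
    qed
    show "(\<lambda>k. group.comm Q (F k) (F' k)) \<in> E" if "F \<in> S" "F' \<in> S" for F F'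
    proof -
      obtain f f' where f: "f \<in> tuples_in \<Gamma>" "F = (\<lambda>l. \<pi> (f (l * int i)))"
        and f': "f' \<in> tuples_in \<Gamma>" "F' = (\<lambda>l. \<pi> (f' (l * int i)))"
          using \<open>F \<in> S\<close> \<open>F' \<in> S\<close> by (auto simp: S_def)
      let ?g = "\<lambda>k. f k \<odot> f' k \<odot> inv\<^bsub>G\<^esub> (f k) \<odot> inv\<^bsub>G\<^esub> (f' k)"
      have "?g \<in> tuples_in \<Gamma>"
        by (intro tuples_in_mult tuples_in_inv \<Gamma>_subgroup f f')
      moreover have "tuple p ?g \<in> D"
        using D_comm[OF tuples_inD(3)[OF f(1)] tuples_inD(3)[OF f'(1)]] mem[OF f(1)] mem[OF f'(1)]
        by (simp add: tuple_mult tuple_inv)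
      ultimately have "?g \<in> tuples_in D" by (simp add: tuples_in_def)
      then show ?thesis unfolding E_def
        by (rule rev_image_eqI) (use f f' mem in \<open>auto simp: h.comm_def\<close>)
    qed
    show "F j = \<one>\<^bsub>Q\<^esub>" if F: "F \<in> E" and off: "\<And>k. \<not> P dvd k - j \<Longrightarrow> F k = \<one>\<^bsub>Q\<^esub>" for F j
    proof -
      obtain f where f: "f \<in> tuples_in D" "F = (\<lambda>l. \<pi> (f (l * int i)))" using F by (auto simp: E_def)
      have "f (j * int i) \<in> R"
      proof (rule last_coordinate_in_R[OF f(1)])
        fix k assume k: "\<not> P dvd k - j * int i"
        have "P dvd k * (int i * m - 1)" using m by simp
        then have km: "P dvd (k * m) * int i - k" by (simp add: algebra_simps)
        then have "\<not> P dvd (k * m) * int i - j * int i" using k dvd_shift_iff by blast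
        then have "F (k * m) = \<one>\<^bsub>Q\<^esub>" using off dvd_i by simp
        then have "f ((k * m) * int i) \<in> R" using f(2) \<pi>_eq_one_iff mem DG[OF f(1)] by simp
        then show "f k \<in> R" using periodicD[OF tuples_inD(1)[OF f(1)] km] by simp
      qed
      then show ?thesis using f(2) \<pi>_eq_one_iff mem DG[OF f(1)] by simp
    qed
    show "(\<lambda>k. if P dvd k - j then \<pi> b else \<pi> a [^]\<^bsub>Q\<^esub> \<beta> ((k - j) * int i)) \<in> S" for j
      using gt gtuple_tuples_in by simp
    show "(\<lambda>k. if P dvd k - j then \<pi> c else \<pi> a [^]\<^bsub>Q\<^esub> \<beta> ((k - j) * int i)) \<in> S" for j
      using gt gtuple_tuples_in by simp
    have "\<beta> (int i) = \<alpha> i" using i by (simp add: \<beta>_def)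
    moreover have "\<beta> (- int i) = \<alpha> (p - i)"
    proof -
      have "(P - int i) mod P = int (p - i)"
        using i mod_pos_pos_trivial[of "P - int i" P] by (simp only: of_nat_diff less_imp_le)
      then have "\<beta> (P - int i) = \<alpha> (p - i)" by (simp only: \<beta>_def nat_int)
      moreover have "\<beta> (- int i) = \<beta> (P - int i)" by (rule \<beta>_periodic) simp
      ultimately show ?thesis by simp
    qed
    moreover have "\<not> P dvd \<alpha> i - \<alpha> (p - i)"
      using i \<alpha>_range[of i] \<alpha>_range[of "p - i"] dvd_small_iff by simp
    ultimately show "\<not> P dvd \<beta> (1 * int i) - \<beta> (- 1 * int i)" by simp
  qed
  show "\<pi> a \<otimes>\<^bsub>Q\<^esub> \<pi> b = \<pi> b \<otimes>\<^bsub>Q\<^esub> \<pi> a"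
    "\<pi> a \<otimes>\<^bsub>Q\<^esub> \<pi> c = \<pi> c \<otimes>\<^bsub>Q\<^esub> \<pi> a"
    "\<pi> b \<otimes>\<^bsub>Q\<^esub> \<pi> c = \<pi> c \<otimes>\<^bsub>Q\<^esub> \<pi> b"
    by (rule gens_commute)+
qed

text \<open>The elements that commute with \<open>T\<close> modulo \<open>R\<close> form a subgroup.\<close>

lemma centralizer_contains_\<Gamma>:
  assumes T: "T \<subseteq> \<Gamma>" and gens: "\<And>x t. x \<in> {a, b, c} \<Longrightarrow> t \<in> T \<Longrightarrow> \<pi> t \<otimes>\<^bsub>Q\<^esub> \<pi> x = \<pi> x \<otimes>\<^bsub>Q\<^esub> \<pi> t"
    and "g \<in> \<Gamma>" "t \<in> T"
  shows "\<pi> t \<otimes>\<^bsub>Q\<^esub> \<pi> g = \<pi> g \<otimes>\<^bsub>Q\<^esub> \<pi> t"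
proof -
  interpret h: group_hom \<Gamma>G Q \<pi> by (rule group_hom_\<pi>)
  define Z where "Z = {g \<in> \<Gamma>. \<forall>t\<in>T. \<pi> t \<otimes>\<^bsub>Q\<^esub> \<pi> g = \<pi> g \<otimes>\<^bsub>Q\<^esub> \<pi> t}"
  have T': "t \<in> T \<Longrightarrow> t \<in> \<Gamma>" for t using T by blast
  have "subgroup Z G"
  proof (rule subgroupI)
    show "Z \<subseteq> carrier G" by (auto simp: Z_def)
    have "\<epsilon> \<in> Z" using T' by (auto simp: Z_def)
    then show "Z \<noteq> {}" by blast
    show "inv\<^bsub>G\<^esub> x \<in> Z" if "x \<in> Z" for x
      using that T' by (auto simp: Z_def h.commutes_inv)
    show "x \<odot> y \<in> Z" if "x \<in> Z" "y \<in> Z" for x y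
      using that T' by (auto simp: Z_def h.commutes_mult)
  qed
  then have "\<Gamma> \<subseteq> Z"
    unfolding EGS_group_def by (rule generate_subgroup_incl[rotated]) (use gens in \<open>auto simp: Z_def\<close>)
  then show ?thesis using assms by (auto simp: Z_def)
qed

lemma D_subset_R: "D \<subseteq> R"
proof -
  have 1: "\<pi> t \<otimes>\<^bsub>Q\<^esub> \<pi> g = \<pi> g \<otimes>\<^bsub>Q\<^esub> \<pi> t" if "g \<in> \<Gamma>" "t \<in> {a, b, c}" for g t
    by (rule centralizer_contains_\<Gamma>[OF _ _ that]) (use gens_commute_mod_R in auto)
  have comm: "\<pi> t \<otimes>\<^bsub>Q\<^esub> \<pi> g = \<pi> g \<otimes>\<^bsub>Q\<^esub> \<pi> t" if "g \<in> \<Gamma>" "t \<in> \<Gamma>" for g t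
    by (rule centralizer_contains_\<Gamma>[OF subset_refl _ that]) (use 1 in auto)
  interpret h: group_hom \<Gamma>G Q \<pi> by (rule group_hom_\<pi>)
  have "g \<odot> k \<odot> inv\<^bsub>G\<^esub> g \<odot> inv\<^bsub>G\<^esub> k \<in> R" if "g \<in> \<Gamma>" "k \<in> \<Gamma>" for g k
  proof -
    have "\<pi> (g \<odot> k \<odot> inv\<^bsub>G\<^esub> g \<odot> inv\<^bsub>G\<^esub> k) = h.comm (\<pi> g) (\<pi> k)" using that by (simp add: h.comm_def)
    also have "\<dots> = \<one>\<^bsub>Q\<^esub>" using that comm by (simp add: h.comm_eq_one_iff)
    finally show ?thesis by (rule iffD1[OF \<pi>_eq_one_iff, rotated]) (use that in simp)
  qed
  then show ?thesis unfolding derived_def by (intro generate_subgroup_incl[OF _ R_subgroup]) auto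
qed

text \<open>The group is regular branch over its derived subgroup.\<close>

lemma single_D: "h \<in> D \<Longrightarrow> tuple p (single 0 h) \<in> D"
  using D_subset_R by (auto simp: R_def)

section \<open>Level stabilizers and exponent sums\<close>

definition d where "d = tuple p (single 0 (c \<odot> inv\<^bsub>G\<^esub> b))"

lemma b_conj: "tuple p (gtuple b 0) = inv\<^bsub>G\<^esub> a \<odot> b \<odot> a"
proof -
  have "b \<odot> a = a \<odot> tuple p (gtuple b 0)"
    using tuple_shift[OF gtuple_closed periodic_gtuple, of b "-1"] b_tuple by (simp add: gtuple_shift)
  then show ?thesis by (simp add: m_assoc inv_solve_left tuple_closed gtuple_closed)
qed

text \<open>Away from the coordinate \<open>0\<close>, \<open>c\<close> and the conjugate of \<open>b\<close> have the same sections.\<close>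

lemma d_eq: "d = c \<odot> inv\<^bsub>G\<^esub> (inv\<^bsub>G\<^esub> a \<odot> b \<odot> a)"
proof -
  have "c \<odot> inv\<^bsub>G\<^esub> (inv\<^bsub>G\<^esub> a \<odot> b \<odot> a) = tuple p (gtuple c 0) \<odot> inv\<^bsub>G\<^esub> (tuple p (gtuple b 0))"
    using b_conj c_tuple by simp
  also have "\<dots> = tuple p (\<lambda>k. gtuple c 0 k \<odot> inv\<^bsub>G\<^esub> (gtuple b 0 k))"
    by (simp add: tuple_mult tuple_inv gtuple_closed)
  also have "\<dots> = d" unfolding d_def by (rule tuple_cong) (simp add: gtuple_def single_def)
  finally show ?thesis by simp
qed

lemma d_mem: "d \<in> \<Gamma>" by (simp add: d_eq)

text \<open>If \<open>d \<odot> t\<close> fixes the level \<open>n\<close>, then \<open>(d \<odot> t, 1, \<dots>, 1)\<close> fixes the level \<open>n + 1\<close>. It is again in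
  the coset of \<open>d\<close>: with \<open>k\<close> the commutator for which \<open>c \<odot> inv b = d \<odot> k\<close>, it is the product of
  \<open>d = (d \<odot> k, 1, \<dots>, 1)\<close> and \<open>(inv k \<odot> t, 1, \<dots>, 1)\<close>.\<close>

lemma deep_elements:
  "\<exists>t\<in>D. \<forall>v\<in>V. length v = n \<longrightarrow> (d \<odot> t) v = v"
proof (induction n)
  case 0
  then show ?case using subgroup.one_closed[OF D_subgroup] d_mem by (intro bexI[of _ \<epsilon>]) auto
next
  case (Suc n)
  then obtain t where t: "t \<in> D" "\<And>v. v \<in> V \<Longrightarrow> length v = n \<Longrightarrow> (d \<odot> t) v = v" by blast
  define k where "k = inv\<^bsub>G\<^esub> a \<odot> b \<odot> inv\<^bsub>G\<^esub> (inv\<^bsub>G\<^esub> a) \<odot> inv\<^bsub>G\<^esub> b"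
  have k: "k \<in> D" unfolding k_def by (rule D_comm) auto
  have in_\<Gamma>: "k \<in> \<Gamma>" "t \<in> \<Gamma>" using k t D_subset by auto
  define s where "s = inv\<^bsub>G\<^esub> k \<odot> t"
  have s: "s \<in> D" using k t D_subgroup by (simp add: s_def subgroup.m_closed subgroup.m_inv_closed)
  have "c \<odot> inv\<^bsub>G\<^esub> b = d \<odot> k"
    by (simp add: d_eq k_def inv_mult_group m_assoc) (simp add: m_assoc[symmetric])
  then have "(c \<odot> inv\<^bsub>G\<^esub> b) \<odot> s = d \<odot> t"
    using in_\<Gamma> d_mem by (simp add: s_def m_assoc) (simp add: m_assoc[symmetric])
  then have dt: "d \<odot> tuple p (single 0 s) = tuple p (single 0 (d \<odot> t))"
    using s D_subset by (auto simp: d_def single_mult subset_iff)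
  have "(d \<odot> tuple p (single 0 s)) v = v" if v: "v \<in> V" "length v = Suc n" for v
  proof -
    obtain j w where "v = j # w" using v by (cases v) auto
    then show ?thesis unfolding dt using v t(2)[of w] by (simp add: single_def)
  qed
  then show ?case using single_D[OF s] by blast
qed

text \<open>The elements of exponent sum \<open>0\<close> in \<open>c\<close>. By \<open>count_GenC_of_trivial_word\<close> it does not
  matter which word represents the element.\<close>

definition K where "K = {word_aut w |w. p dvd count_list w GenC}"

lemma K_subgroup: "subgroup K G"
proof (rule subgroupI)
  show "K \<subseteq> carrier G" by (auto simp: K_def)
  have "word_aut [] \<in> K" unfolding K_def by (intro CollectI exI[of _ "[]"]) simp
  then show "K \<noteq> {}" by blast
  show "inv\<^bsub>G\<^esub> x \<in> K" if "x \<in> K" for x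
  proof -
    obtain w where "x = word_aut w" "p dvd count_list w GenC" using \<open>x \<in> K\<close> by (auto simp: K_def)
    then show ?thesis
      unfolding K_def
      by (intro CollectI exI[of _ "inv_word w"]) (simp add: word_aut_inv_word count_inv_word)
  qed
  show "x \<odot> y \<in> K" if "x \<in> K" "y \<in> K" for x y
  proof -
    obtain w u where "x = word_aut w" "p dvd count_list w GenC" "y = word_aut u" "p dvd count_list u GenC"
      using \<open>x \<in> K\<close> \<open>y \<in> K\<close> by (auto simp: K_def)
    then show ?thesis
      unfolding K_def by (intro CollectI exI[of _ "w @ u"]) (simp add: word_aut_append)
  qed
qed

lemma K_subset: "K \<subseteq> \<Gamma>" by (auto simp: K_def \<Gamma>_eq_words)

lemma D_subset_K: "D \<subseteq> K"
  unfolding derived_def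
proof (rule generate_subgroup_incl[OF _ K_subgroup], safe)
  fix g h assume "g \<in> \<Gamma>" "h \<in> \<Gamma>"
  then obtain u w where u: "g = word_aut u" and w: "h = word_aut w" unfolding \<Gamma>_eq_words by blast
  let ?x = "u @ w @ inv_word u @ inv_word w"
  have "g \<odot> h \<odot> inv\<^bsub>G\<^esub> g \<odot> inv\<^bsub>G\<^esub> h = word_aut ?x"
    by (simp add: u w word_aut_append word_aut_inv_word m_assoc)
  moreover have "count_list ?x GenC = p * (count_list u GenC + count_list w GenC)"
  proof -
    have "x + (p - 1) * x = p * x" for x
      using mult_eq_if[of p x] p_pos by simp
    from this[of "count_list u GenC"] this[of "count_list w GenC"] show ?thesis
      by (simp add: count_inv_word algebra_simps)
  qed
  ultimately show "g \<odot> h \<odot> inv\<^bsub>G\<^esub> g \<odot> inv\<^bsub>G\<^esub> h \<in> K" unfolding K_def by auto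
qed

lemma d_not_in_K: "d \<notin> K"
proof
  assume "d \<in> K"
  then obtain w where w: "d = word_aut w" "p dvd count_list w GenC" by (auto simp: K_def)
  define u where "u = [GenC] @ inv_word (inv_word [GenA] @ [GenB, GenA])"
  have "word_aut u = d"
    by (simp add: u_def word_aut_append word_aut_inv_word d_eq m_assoc del: inv_word_simps)
  then have "word_aut (u @ inv_word w) = \<epsilon>"
    using w d_mem by (simp add: word_aut_append word_aut_inv_word)
  then have "p dvd count_list (u @ inv_word w) GenC" by (rule count_GenC_of_trivial_word)
  moreover have "count_list u GenC = 1" by (simp add: u_def count_inv_word del: inv_word_simps)
  ultimately have "p dvd 1 + (p - 1) * count_list w GenC" by (simp add: count_inv_word)
  then have "p dvd 1" using w(2) by (metis dvd_add_left_iff dvd_mult)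
  then show False using p_pos by simp
qed

lemma finite_index_K: "finite (rcosets\<^bsub>\<Gamma>G\<^esub> K)"
proof -
  interpret \<Gamma>: group \<Gamma>G by (rule subgroup_imp_group[OF \<Gamma>_subgroup])
  have K: "subgroup K \<Gamma>G" by (rule subgroup_incl[OF K_subgroup \<Gamma>_subgroup K_subset])
  have "rcosets\<^bsub>\<Gamma>G\<^esub> K \<subseteq> (\<lambda>n. K #>\<^bsub>\<Gamma>G\<^esub> word_aut (replicate n GenC)) ` {..<p}"
  proof
    fix X assume "X \<in> rcosets\<^bsub>\<Gamma>G\<^esub> K"
    then obtain x where x: "x \<in> \<Gamma>" "X = K #>\<^bsub>\<Gamma>G\<^esub> x" by (auto simp: RCOSETS_def)
    obtain w where w: "x = word_aut w" using x(1) unfolding \<Gamma>_eq_words by blast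
    define n where "n = count_list w GenC mod p"
    let ?u = "replicate n GenC @ inv_word w"
    have "p dvd n + (p - 1) * count_list w GenC"
    proof -
      have "(n + (p - 1) * count_list w GenC) mod p =
          (count_list w GenC + (p - 1) * count_list w GenC) mod p"
        by (simp add: n_def mod_simps)
      also have "count_list w GenC + (p - 1) * count_list w GenC = p * count_list w GenC"
        using p_pos by (cases p) simp_all
      finally show ?thesis by (simp add: dvd_eq_mod_eq_0)
    qed
    then have "word_aut ?u \<in> K"
      unfolding K_def by (intro CollectI exI[of _ ?u]) (simp add: count_inv_word)
    moreover have "word_aut (replicate n GenC) = word_aut ?u \<odot> x"
      using w by (simp add: word_aut_append word_aut_inv_word m_assoc)
    ultimately have "word_aut (replicate n GenC) \<in> K #>\<^bsub>\<Gamma>G\<^esub> x"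
      unfolding r_coset_def by auto
    then have "X = K #>\<^bsub>\<Gamma>G\<^esub> word_aut (replicate n GenC)"
      using \<Gamma>.repr_independence[OF _ _ K] x by simp
    moreover have "n < p" using p_pos by (simp add: n_def)
    ultimately show "X \<in> (\<lambda>n. K #>\<^bsub>\<Gamma>G\<^esub> word_aut (replicate n GenC)) ` {..<p}" by blast
  qed
  then show ?thesis using finite_subset by blast
qed

theorem not_congruence_property: "\<not> congruence_property p \<Gamma>"
proof
  assume "congruence_property p \<Gamma>"
  moreover have "subgroup K \<Gamma>G" by (rule subgroup_incl[OF K_subgroup \<Gamma>_subgroup K_subset])
  ultimately have "congruence_subgroup p \<Gamma> K"
    using finite_index_K by (simp add: congruence_property_def)
  then obtain n where n: "level_stab p \<Gamma> n \<subseteq> K" by (auto simp: congruence_subgroup_def)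
  obtain t where t: "t \<in> D" "\<forall>v\<in>V. length v = n \<longrightarrow> (d \<odot> t) v = v" using deep_elements by blast
  have t\<Gamma>: "t \<in> \<Gamma>" using t D_subset by blast
  then have "d \<odot> t \<in> K" using n t d_mem by (auto simp: level_stab_def)
  moreover have "inv\<^bsub>G\<^esub> t \<in> K" using t D_subset_K subgroup.m_inv_closed[OF K_subgroup] by blast
  ultimately have "d \<odot> t \<odot> inv\<^bsub>G\<^esub> t \<in> K" using subgroup.m_closed[OF K_subgroup] by blast
  then have "d \<in> K" using t\<Gamma> d_mem by (simp add: m_assoc)
  then show False using d_not_in_K by blast
qed

end

theorem theorem3p1:
  fixes p :: nat and \<alpha> :: "nat \<Rightarrow> int"
  assumes "prime p" and "p \<ge> 3"
    and "\<alpha> \<in> {1..p - 1} \<rightarrow> carrier (residue_ring (int p))"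
    and "(\<Oplus>\<^bsub>residue_ring (int p)\<^esub>i\<in>{1..p - 1}. \<alpha> i) = \<zero>\<^bsub>residue_ring (int p)\<^esub>"
    and "\<not> symmetric_vector p \<alpha>"
  shows "\<not> congruence_property p (EGS_group p \<alpha>)"
proof -
  interpret egs p \<alpha>
  proof
    show "prime p" "p \<ge> 3" using assms by simp_all
    show "0 \<le> \<alpha> i \<and> \<alpha> i < int p" if "1 \<le> i" "i < p" for i
    proof -
      have "i \<in> {1..p - 1}" using that by auto
      then have "\<alpha> i \<in> carrier (residue_ring (int p))" using assms(3) by blast
      then show ?thesis by (auto simp: residue_ring_def)
    qed
    obtain i where "i \<in> {1..(p - 1) div 2}" "\<alpha> i \<noteq> \<alpha> (p - i)"
      using assms(5) by (auto simp: symmetric_vector_def)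
    then show "\<exists>i\<ge>1. i < p \<and> \<alpha> i \<noteq> \<alpha> (p - i)" using assms(2) by (intro exI[of _ i]) auto
  qed
  show ?thesis by (rule not_congruence_property)
qed

end
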